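(* Let $\mu=\mathrm{e}^{-\beta V}$ and $\rho=\mathrm{e}^{-\alpha\beta}\in(0,1)$ with $\beta>0$, $\alpha>0$, $V\in\mathbb{R}$, and let $\gamma:=\sqrt{1-\rho^2}$. Let $G$ be the transfer operator associated with the one-dimensional Manhattan elastic dimer-monomer system, acting on functions $h\in\mathbb{H}$ by $$G(h)(x):=(\mu+x)\int_{\mathbb{R}}h(y)\,\frac{\mathrm{e}^{-(y-\rho x)^2/(2\gamma^2)}}{\sqrt{2\pi}\,\gamma}\,\mathrm{d}y,\qquad x\in\mathbb{R}.$$ Then $G$ can be expressed in terms of the operators $R$, $A$, $A^{\dagger}$ defined in the context as $$G=(\mu I+A+A^{\dagger})R,$$ where $I$ is the identity operator, and the matrix representation of $G$ in the orthonormal basis $(h_k)_{k\geq0}$ of normalized Hermite polynomials is the infinite tridiagonal matrix $(g_{jk})_{j,k\geq0}$, $g_{jk}=\langle h_j,G(h_k)\rangle$, with $$g_{kk}=\mu\rho^k,\qquad g_{k+1,k}=\sqrt{k+1}\,\rho^k,\qquad g_{k,k+1}=\sqrt{k+1}\,\rho^{k+1}\qquad (k\geq0),$$ and all other entries equal to zero, that is, $$\begin{bmatrix}\mu&\rho&0&0&\cdots\\ 1&\mu\rho&\sqrt2\,\rho^2&0&\cdots\\ 0&\sqrt2\,\rho&\mu\rho^2&\sqrt3\,\rho^3&\cdots\\ 0&0&\sqrt3\,\rho^2&\mu\rho^3&\cdots\\ \vdots&\vdots&\vdots&\vdots&\ddots\end{bmatrix}.$$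
   Context: $\mathbb{H}$ is the Hilbert space of functions $h:\mathbb{R}\to\mathbb{R}$ which are square integrable with respect to the standard normal density $\nu(x)=\mathrm{e}^{-x^2/2}/\sqrt{2\pi}$, with inner product $\langle f,g\rangle:=\int_{\mathbb{R}}f(x)g(x)\nu(x)\,\mathrm{d}x$. The (modified) Hermite polynomials are $H_k(x):=(-1)^k\mathrm{e}^{x^2/2}\frac{\mathrm{d}^k}{\mathrm{d}x^k}\mathrm{e}^{-x^2/2}$, and $h_k:=H_k/\sqrt{k!}$, $k\geq0$, form an orthonormal basis of $\mathbb{H}$. The linear operators $R$, $A$, $A^{\dagger}$ act on the basis functions by $$R(h_k):=\rho^kh_k,\qquad A(h_k):=\sqrt{k}\,h_{k-1},\qquad A^{\dagger}(h_k):=\sqrt{k+1}\,h_{k+1}\qquad(k\geq0),$$ with $A(h_0)=0$. The operators $A$ and $A^{\dagger}$ are unbounded, being defined on the linear manifold of those $h\in\mathbb{H}$ with $\sum_{k\geq1}k\langle h,h_k\rangle^2<+\infty$, while $R$, $AR$ and $A^{\dagger}R$ are bounded operators on the whole of $\mathbb{H}$ because $0<\rho<1$. Here $\beta$ is the inverse temperature, $V$ the monomer energy and $\alpha$ the parameter of the dimer potential $W(z)=\alpha|z|$, $z\in\mathbb{Z}$. *)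

theory Defs
  imports "HOL-Probability.Probability" "HOL-Computational_Algebra.Polynomial"
begin

section \<open>The Hilbert space of functions square integrable for the standard normal law\<close>

definition normal_L2 :: "(real \<Rightarrow> real) set" where
  "normal_L2 = {f \<in> borel_measurable borel. integrable std_normal_distribution (\<lambda>x. (f x)\<^sup>2)}"

lemma normal_L2_measurable: "f \<in> normal_L2 \<Longrightarrow> f \<in> borel_measurable borel"
  by (simp add: normal_L2_def)

lemma normal_L2_square: "f \<in> normal_L2 \<Longrightarrow> integrable std_normal_distribution (\<lambda>x. (f x)\<^sup>2)"
  by (simp add: normal_L2_def)

lemma normal_L2_mult:
  assumes "f \<in> normal_L2" "g \<in> normal_L2"
  shows "integrable std_normal_distribution (\<lambda>x. f x * g x)"
proof (rule Bochner_Integration.integrable_bound)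
  show "integrable std_normal_distribution (\<lambda>x. (f x)\<^sup>2 + (g x)\<^sup>2)"
    using assms by (auto intro: normal_L2_square)
  show "(\<lambda>x. f x * g x) \<in> borel_measurable std_normal_distribution"
    using assms[THEN normal_L2_measurable] by simp
  have "\<bar>a * b\<bar> \<le> \<bar>a\<^sup>2 + b\<^sup>2\<bar>" for a b :: real
  proof -
    have "2 * \<bar>a * b\<bar> \<le> a\<^sup>2 + b\<^sup>2"
      using sum_squares_bound[of "\<bar>a\<bar>" "\<bar>b\<bar>"] by (simp add: abs_mult)
    then show ?thesis by linarith
  qed
  then show "AE x in std_normal_distribution. norm (f x * g x) \<le> norm ((f x)\<^sup>2 + (g x)\<^sup>2)"
    by simp
qed

lemma normal_L2_zero: "(\<lambda>_. 0) \<in> normal_L2"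
  by (simp add: normal_L2_def)

lemma normal_L2_add:
  assumes "f \<in> normal_L2" "g \<in> normal_L2"
  shows "(\<lambda>x. f x + g x) \<in> normal_L2"
proof -
  have "integrable std_normal_distribution (\<lambda>x. (f x)\<^sup>2 + (g x)\<^sup>2 + 2 * (f x * g x))"
    using assms by (intro Bochner_Integration.integrable_add integrable_mult_right
        normal_L2_square normal_L2_mult)
  also have "(\<lambda>x. (f x)\<^sup>2 + (g x)\<^sup>2 + 2 * (f x * g x)) = (\<lambda>x. (f x + g x)\<^sup>2)"
    by (simp add: power2_sum mult.assoc)
  finally show ?thesis
    using assms[THEN normal_L2_measurable] by (simp add: normal_L2_def)
qed

lemma normal_L2_scale: "f \<in> normal_L2 \<Longrightarrow> (\<lambda>x. c * f x) \<in> normal_L2"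
  by (auto simp: normal_L2_def power_mult_distrib)

lemma normal_L2_uminus: "f \<in> normal_L2 \<Longrightarrow> (\<lambda>x. - f x) \<in> normal_L2"
  by (simp add: normal_L2_def)

lemma normal_L2_diff:
  "f \<in> normal_L2 \<Longrightarrow> g \<in> normal_L2 \<Longrightarrow> (\<lambda>x. f x - g x) \<in> normal_L2"
  using normal_L2_add[OF _ normal_L2_uminus, of f g] by simp

definition normal_L2_rel :: "(real \<Rightarrow> real) \<Rightarrow> (real \<Rightarrow> real) \<Rightarrow> bool" where
  "normal_L2_rel f g \<longleftrightarrow>
     f \<in> normal_L2 \<and> g \<in> normal_L2 \<and> (AE x in std_normal_distribution. f x = g x)"

lemma normal_L2_rel_refl: "normal_L2_rel f f \<longleftrightarrow> f \<in> normal_L2"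
  by (simp add: normal_L2_rel_def)

text \<open>
  The space \<open>\<bbbH>\<close>: classes of square integrable functions modulo equality almost
  everywhere. Representatives are Borel measurable, which covers all classes, since every Lebesgue
  measurable function agrees almost everywhere with a Borel measurable one.
\<close>

quotient_type hspace = "real \<Rightarrow> real" / partial: normal_L2_rel
proof (rule part_equivpI)
  show "\<exists>f. normal_L2_rel f f"
    using normal_L2_zero normal_L2_rel_refl by blast
  show "symp normal_L2_rel"
    by (rule sympI) (auto simp: normal_L2_rel_def elim: eventually_mono)
  show "transp normal_L2_rel"
  proof (rule transpI)
    fix f g h assume *: "normal_L2_rel f g" "normal_L2_rel g h"
    then have "AE x in std_normal_distribution. f x = g x"
      "AE x in std_normal_distribution. g x = h x"
      by (simp_all add: normal_L2_rel_def)
    then have "AE x in std_normal_distribution. f x = h x"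
      by eventually_elim simp
    with * show "normal_L2_rel f h"
      by (simp add: normal_L2_rel_def)
  qed
qed

instantiation hspace :: real_vector
begin

lift_definition zero_hspace :: hspace is "\<lambda>_. 0"
  by (simp add: normal_L2_rel_refl normal_L2_zero)

lift_definition plus_hspace :: "hspace \<Rightarrow> hspace \<Rightarrow> hspace" is "\<lambda>f g x. f x + g x"
  unfolding normal_L2_rel_def by (auto intro: normal_L2_add elim: AE_mp)

lift_definition uminus_hspace :: "hspace \<Rightarrow> hspace" is "\<lambda>f x. - f x"
  unfolding normal_L2_rel_def by (auto intro: normal_L2_uminus)

lift_definition minus_hspace :: "hspace \<Rightarrow> hspace \<Rightarrow> hspace" is "\<lambda>f g x. f x - g x"
  unfolding normal_L2_rel_def by (auto intro: normal_L2_diff elim: AE_mp)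

lift_definition scaleR_hspace :: "real \<Rightarrow> hspace \<Rightarrow> hspace" is "\<lambda>c f x. c * f x"
  unfolding normal_L2_rel_def by (auto intro: normal_L2_scale elim: AE_mp)

instance
proof
  fix a b c :: hspace and r s :: real
  show "a + b + c = a + (b + c)"
    by transfer (auto simp: normal_L2_rel_def add.assoc intro!: normal_L2_add)
  show "a + b = b + a"
    by transfer (auto simp: normal_L2_rel_def add.commute intro!: normal_L2_add)
  show "0 + a = a"
    by transfer (auto simp: normal_L2_rel_def)
  show "- a + a = 0"
    by transfer (auto simp: normal_L2_rel_def normal_L2_zero)
  show "a - b = a + - b"
    by transfer (auto simp: normal_L2_rel_def intro!: normal_L2_diff)
  show "r *\<^sub>R (a + b) = r *\<^sub>R a + r *\<^sub>R b"
    by transfer (auto simp: normal_L2_rel_def distrib_left intro!: normal_L2_add normal_L2_scale)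
  show "(r + s) *\<^sub>R a = r *\<^sub>R a + s *\<^sub>R a"
    by transfer (auto simp: normal_L2_rel_def distrib_right intro!: normal_L2_add normal_L2_scale)
  show "r *\<^sub>R s *\<^sub>R a = (r * s) *\<^sub>R a"
    by transfer (auto simp: normal_L2_rel_def mult.assoc intro!: normal_L2_scale)
  show "1 *\<^sub>R a = a"
    by transfer (auto simp: normal_L2_rel_def)
qed

end

instantiation hspace :: real_inner
begin

lift_definition inner_hspace :: "hspace \<Rightarrow> hspace \<Rightarrow> real"
  is "\<lambda>f g. \<integral>x. f x * g x \<partial>std_normal_distribution"
proof -
  fix f f' g g' assume *: "normal_L2_rel f f'" "normal_L2_rel g g'"
  then have "AE x in std_normal_distribution. f x = f' x"
    "AE x in std_normal_distribution. g x = g' x"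
    by (simp_all add: normal_L2_rel_def)
  then have "AE x in std_normal_distribution. f x * g x = f' x * g' x"
    by eventually_elim simp
  then show "(\<integral>x. f x * g x \<partial>std_normal_distribution) = (\<integral>x. f' x * g' x \<partial>std_normal_distribution)"
    using * by (intro integral_cong_AE)
      (auto simp: normal_L2_rel_def normal_L2_def)
qed

definition norm_hspace :: "hspace \<Rightarrow> real" where "norm_hspace h = sqrt (h \<bullet> h)"
definition sgn_hspace :: "hspace \<Rightarrow> hspace" where "sgn_hspace h = h /\<^sub>R norm h"
definition dist_hspace :: "hspace \<Rightarrow> hspace \<Rightarrow> real" where "dist_hspace g h = norm (g - h)"
definition uniformity_hspace :: "(hspace \<times> hspace) filter"
  where "uniformity_hspace = (INF e\<in>{0<..}. principal {(x, y). dist x y < e})"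
definition open_hspace :: "hspace set \<Rightarrow> bool"
  where "open_hspace U \<longleftrightarrow> (\<forall>x\<in>U. \<forall>\<^sub>F (x', y) in uniformity. x' = x \<longrightarrow> y \<in> U)"

instance
proof
  fix a b c :: hspace and r :: real and U :: "hspace set"
  show "a \<bullet> b = b \<bullet> a"
    by transfer (simp add: mult.commute)
  show "(a + b) \<bullet> c = a \<bullet> c + b \<bullet> c"
  proof transfer
    fix a b c assume "normal_L2_rel a a" "normal_L2_rel b b" "normal_L2_rel c c"
    then show "(\<integral>x. (a x + b x) * c x \<partial>std_normal_distribution) =
      (\<integral>x. a x * c x \<partial>std_normal_distribution) + (\<integral>x. b x * c x \<partial>std_normal_distribution)"
      by (simp add: normal_L2_rel_refl distrib_right normal_L2_mult)
  qed
  show "r *\<^sub>R a \<bullet> b = r * (a \<bullet> b)"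
    by transfer (simp add: mult.assoc)
  show "0 \<le> a \<bullet> a"
    by transfer simp
  show "a \<bullet> a = 0 \<longleftrightarrow> a = 0"
  proof transfer
    fix f assume "normal_L2_rel f f"
    then have f: "f \<in> normal_L2" by (simp add: normal_L2_rel_refl)
    have "(\<integral>x. f x * f x \<partial>std_normal_distribution) = 0 \<longleftrightarrow>
        (AE x in std_normal_distribution. f x * f x = 0)"
      by (rule integral_nonneg_eq_0_iff_AE) (simp_all add: f normal_L2_mult)
    then show "(\<integral>x. f x * f x \<partial>std_normal_distribution) = 0 \<longleftrightarrow> normal_L2_rel f (\<lambda>_. 0)"
      by (simp add: normal_L2_rel_def f normal_L2_zero)
  qed
qed (simp_all add: norm_hspace_def sgn_hspace_def dist_hspace_def
    uniformity_hspace_def open_hspace_def)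

end

lemma inner_abs_hspace:
  assumes "f \<in> normal_L2" "g \<in> normal_L2"
  shows "abs_hspace f \<bullet> abs_hspace g = (\<integral>x. f x * g x \<partial>std_normal_distribution)"
  using assms by (simp add: inner_hspace.abs_eq normal_L2_rel_refl)

lemma norm_abs_hspace:
  "f \<in> normal_L2 \<Longrightarrow> norm (abs_hspace f) ^ 2 = (\<integral>x. (f x)\<^sup>2 \<partial>std_normal_distribution)"
  by (simp add: norm_hspace_def inner_abs_hspace power2_eq_square)

lemma hspace_cases:
  obtains f where "f \<in> normal_L2" "h = abs_hspace f"
  by (metis Quotient3_hspace Quotient3_def normal_L2_rel_refl)

lemma abs_hspace_diff:
  "f \<in> normal_L2 \<Longrightarrow> g \<in> normal_L2 \<Longrightarrow> abs_hspace f - abs_hspace g = abs_hspace (\<lambda>x. f x - g x)"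
  by (simp add: minus_hspace.abs_eq normal_L2_rel_refl)

lemma prob_space_std_normal_distribution: "prob_space std_normal_distribution"
  by (simp add: prob_space_normal_density)

lemma normal_L2_const: "(\<lambda>_. c) \<in> normal_L2"
proof -
  interpret prob_space std_normal_distribution
    by (rule prob_space_std_normal_distribution)
  show ?thesis by (simp add: normal_L2_def)
qed

lemma hspace_L1_le_norm:
  assumes f: "f \<in> normal_L2"
  shows "(\<integral>x. \<bar>f x\<bar> \<partial>std_normal_distribution) \<le> norm (abs_hspace f)"
proof -
  interpret prob_space std_normal_distribution
    by (rule prob_space_std_normal_distribution)
  have af: "(\<lambda>x. \<bar>f x\<bar>) \<in> normal_L2"
    using f by (auto simp: normal_L2_def)
  have n: "norm (abs_hspace (\<lambda>x. \<bar>f x\<bar>)) = norm (abs_hspace f)"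
    by (simp add: norm_hspace_def inner_abs_hspace f af flip: abs_mult)
  have one: "norm (abs_hspace (\<lambda>_. 1)) = 1"
    using prob_space
    by (simp add: norm_hspace_def inner_abs_hspace normal_L2_const)
  have "(\<integral>x. \<bar>f x\<bar> \<partial>std_normal_distribution) =
      abs_hspace (\<lambda>x. \<bar>f x\<bar>) \<bullet> abs_hspace (\<lambda>_. 1)"
    by (simp add: inner_abs_hspace af normal_L2_const)
  also have "\<dots> \<le> norm (abs_hspace (\<lambda>x. \<bar>f x\<bar>)) * norm (abs_hspace (\<lambda>_. 1))"
    by (rule norm_cauchy_schwarz)
  finally show ?thesis by (simp add: n one)
qed

subsection \<open>Completeness\<close>

instance hspace :: complete_space
proof
  fix X :: "nat \<Rightarrow> hspace"
  assume X: "Cauchy X"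
  let ?N = std_normal_distribution
  have "\<exists>r. strict_mono r \<and> (\<forall>n. \<forall>m\<ge>r n. \<forall>k\<ge>r n. norm (X m - X k) < (1/2) ^ n)"
  proof -
    have "\<exists>M. \<forall>m\<ge>M. \<forall>k\<ge>M. norm (X m - X k) < (1/2) ^ n" for n :: nat
      using CauchyD[OF X, of "(1/2)^n"] by simp
    then obtain M where M: "\<And>n m k. m \<ge> M n \<Longrightarrow> k \<ge> M n \<Longrightarrow> norm (X m - X k) < (1/2) ^ n"
      by metis
    define r where "r = rec_nat (M 0) (\<lambda>n p. max (Suc p) (M (Suc n)))"
    have r: "r 0 = M 0" "r (Suc n) = max (Suc (r n)) (M (Suc n))" for n
      by (simp_all add: r_def)
    have "strict_mono r"
      by (rule strict_monoI_Suc) (simp add: r)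
    moreover have "M n \<le> r n" for n
      by (cases n) (simp_all add: r)
    ultimately show ?thesis
      using M by (meson order_trans)
  qed
  then obtain r where r: "strict_mono r"
    "\<And>n m k. m \<ge> r n \<Longrightarrow> k \<ge> r n \<Longrightarrow> norm (X m - X k) < (1/2) ^ n" by blast
  have "\<forall>n. \<exists>f. f \<in> normal_L2 \<and> X (r n) = abs_hspace f"
    by (metis hspace_cases)
  then obtain f where f: "\<And>n. f n \<in> normal_L2" "\<And>n. X (r n) = abs_hspace (f n)"
    by metis
  have [measurable]: "f n \<in> borel_measurable borel" for n
    using f(1) by (rule normal_L2_measurable)
  have d: "(\<lambda>x. f m x - f n x) \<in> normal_L2" for m n
    by (intro normal_L2_diff f)
  have nd: "norm (abs_hspace (\<lambda>x. f m x - f n x)) < (1/2) ^ n" if "n \<le> m" for m n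
    using r(2)[of n "r m" "r n"] strict_mono_leD[OF r(1) that]
    by (simp add: f abs_hspace_diff)
  have "AE x in ?N. summable (\<lambda>n. f (Suc n) x - f n x)"
  proof -
    have i: "integrable ?N (\<lambda>x. \<bar>f (Suc n) x - f n x\<bar>)" for n
      using normal_L2_mult[OF d normal_L2_const[of 1], of "Suc n" n] by simp
    have "(\<integral>\<^sup>+x. (\<Sum>n. ennreal \<bar>f (Suc n) x - f n x\<bar>) \<partial>?N) =
        (\<Sum>n. \<integral>\<^sup>+x. ennreal \<bar>f (Suc n) x - f n x\<bar> \<partial>?N)"
      by (rule nn_integral_suminf) simp
    also have "\<dots> = (\<Sum>n. ennreal (\<integral>x. \<bar>f (Suc n) x - f n x\<bar> \<partial>?N))"
      by (simp add: nn_integral_eq_integral i)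
    also have "\<dots> \<le> (\<Sum>n. ennreal ((1/2) ^ n))"
    proof (intro suminf_le ennreal_leI summableI)
      fix n
      have "(\<integral>x. \<bar>f (Suc n) x - f n x\<bar> \<partial>?N) \<le> norm (abs_hspace (\<lambda>x. f (Suc n) x - f n x))"
        by (rule hspace_L1_le_norm[OF d])
      then show "(\<integral>x. \<bar>f (Suc n) x - f n x\<bar> \<partial>?N) \<le> (1/2) ^ n"
        using nd[of n "Suc n"] by simp
    qed
    also have "\<dots> = ennreal (\<Sum>n. (1/2) ^ n)"
      by (rule suminf_ennreal2) (simp_all add: summable_geometric)
    also have "\<dots> < \<infinity>" by simp
    finally have "AE x in ?N. (\<Sum>n. ennreal \<bar>f (Suc n) x - f n x\<bar>) \<noteq> \<infinity>"
      by (intro nn_integral_PInf_AE) auto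
    then show ?thesis
    proof eventually_elim
      case (elim x)
      then have "summable (\<lambda>n. \<bar>f (Suc n) x - f n x\<bar>)"
        by (intro summable_suminf_not_top) auto
      then show ?case by (rule summable_rabs_cancel)
    qed
  qed
  then have conv: "AE x in ?N. (\<lambda>n. f n x) \<longlonglongrightarrow> lim (\<lambda>n. f n x)"
  proof eventually_elim
    case (elim x)
    then have "convergent (\<lambda>n. f n x - f 0 x)"
      by (simp add: summable_iff_convergent sum_lessThan_telescope[of "\<lambda>n. f n x"])
    then have "convergent (\<lambda>n. f n x - f 0 x + f 0 x)"
      by (intro convergent_add convergent_const)
    then have "convergent (\<lambda>n. f n x)"
      by simp
    then show ?case by (simp add: convergent_LIMSEQ_iff)
  qed
  define F where "F = (\<lambda>x. lim (\<lambda>n. f n x))"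
  have [measurable]: "F \<in> borel_measurable borel"
    unfolding F_def by measurable
  have F: "(\<integral>\<^sup>+x. ennreal ((F x - f n x)\<^sup>2) \<partial>?N) \<le> ennreal (((1/2) ^ n)\<^sup>2)" for n
  proof -
    have "(\<integral>\<^sup>+x. ennreal ((F x - f n x)\<^sup>2) \<partial>?N) =
        (\<integral>\<^sup>+x. liminf (\<lambda>m. ennreal ((f m x - f n x)\<^sup>2)) \<partial>?N)"
    proof (rule nn_integral_cong_AE)
      from conv show "AE x in ?N. ennreal ((F x - f n x)\<^sup>2) = liminf (\<lambda>m. ennreal ((f m x - f n x)\<^sup>2))"
      proof eventually_elim
        case (elim x)
        then have "(\<lambda>m. ennreal ((f m x - f n x)\<^sup>2)) \<longlonglongrightarrow> ennreal ((F x - f n x)\<^sup>2)"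
          unfolding F_def
          by (intro tendsto_ennrealI tendsto_power tendsto_diff tendsto_const)
        then show ?case
          by (rule lim_imp_Liminf[OF trivial_limit_sequentially, symmetric])
      qed
    qed
    also have "\<dots> \<le> liminf (\<lambda>m. \<integral>\<^sup>+x. ennreal ((f m x - f n x)\<^sup>2) \<partial>?N)"
      by (rule nn_integral_liminf) simp
    also have "\<dots> \<le> liminf (\<lambda>m. ennreal (((1/2) ^ n)\<^sup>2))"
    proof (rule Liminf_mono)
      show "\<forall>\<^sub>F m in sequentially. (\<integral>\<^sup>+x. ennreal ((f m x - f n x)\<^sup>2) \<partial>?N) \<le> ennreal (((1/2) ^ n)\<^sup>2)"
        using eventually_ge_at_top[of n]
      proof eventually_elim
        case (elim m)
        have "(\<integral>\<^sup>+x. ennreal ((f m x - f n x)\<^sup>2) \<partial>?N) = ennreal ((norm (abs_hspace (\<lambda>x. f m x - f n x)))\<^sup>2)"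
          using normal_L2_square[OF d] by (simp add: nn_integral_eq_integral norm_abs_hspace d)
        also have "\<dots> \<le> ennreal (((1/2) ^ n)\<^sup>2)"
          using nd[OF elim] by (intro ennreal_leI power_mono) auto
        finally show ?case .
      qed
    qed
    also have "\<dots> = ennreal (((1/2) ^ n)\<^sup>2)"
      by (simp add: Liminf_const)
    finally show ?thesis .
  qed
  have D: "(\<lambda>x. F x - f n x) \<in> normal_L2" for n
    using F[of n] by (auto simp: normal_L2_def integrable_iff_bounded intro: le_less_trans)
  have FL2: "F \<in> normal_L2"
    using normal_L2_add[OF D f(1), of 0 0] by simp
  have bound: "norm (abs_hspace F - X (r n)) \<le> (1/2) ^ n" for n
  proof -
    have "ennreal ((norm (abs_hspace F - X (r n)))\<^sup>2) = (\<integral>\<^sup>+x. ennreal ((F x - f n x)\<^sup>2) \<partial>?N)"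
      using normal_L2_square[OF D, of n]
      by (simp add: nn_integral_eq_integral norm_abs_hspace f abs_hspace_diff FL2 D)
    with F[of n] have "ennreal ((norm (abs_hspace F - X (r n)))\<^sup>2) \<le> ennreal (((1/2) ^ n)\<^sup>2)"
      by (simp only:)
    then have "(norm (abs_hspace F - X (r n)))\<^sup>2 \<le> ((1/2) ^ n)\<^sup>2"
      by (simp only: ennreal_le_iff zero_le_power2)
    then show ?thesis by (rule power2_le_imp_le) simp
  qed
  have "(\<lambda>n. X (r n)) \<longlonglongrightarrow> abs_hspace F"
  proof (rule LIMSEQ_I)
    fix e :: real assume "0 < e"
    then have "\<forall>\<^sub>F n in sequentially. (1/2) ^ n < e"
      by (intro order_tendstoD(2)[OF LIMSEQ_realpow_zero]) auto
    then show "\<exists>M. \<forall>n\<ge>M. norm (X (r n) - abs_hspace F) < e"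
      using bound by (auto simp: eventually_sequentially norm_minus_commute intro: le_less_trans)
  qed
  then show "convergent X"
    using Cauchy_converges_subseq[OF X r(1)] by (auto simp: convergent_def o_def)
qed

instance hspace :: banach ..

section \<open>Hermite polynomials\<close>

definition hermite :: "nat \<Rightarrow> real \<Rightarrow> real" where
  "hermite k x = (-1) ^ k * exp (x\<^sup>2 / 2) * (deriv ^^ k) (\<lambda>t. exp (- t\<^sup>2 / 2)) x"

definition normalized_hermite :: "nat \<Rightarrow> real \<Rightarrow> real" where
  "normalized_hermite k x = hermite k x / sqrt (fact k)"

fun hermite_poly :: "nat \<Rightarrow> real poly" where
  "hermite_poly 0 = 1"
| "hermite_poly (Suc k) = pCons 0 (hermite_poly k) - pderiv (hermite_poly k)"

lemma deriv_gauss_hermite_poly: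
  "(deriv ^^ k) (\<lambda>t. exp (- t\<^sup>2 / 2)) =
     (\<lambda>x :: real. (-1) ^ k * poly (hermite_poly k) x * exp (- x\<^sup>2 / 2))"
proof (induction k)
  case (Suc k)
  have "((\<lambda>x. (-1) ^ k * poly (hermite_poly k) x * exp (- x\<^sup>2 / 2)) has_real_derivative
      (-1) ^ Suc k * poly (hermite_poly (Suc k)) x * exp (- x\<^sup>2 / 2)) (at x)" for x :: real
    by (rule derivative_eq_intros poly_DERIV refl | simp)+ (simp add: algebra_simps)
  then have "deriv (\<lambda>x. (-1) ^ k * poly (hermite_poly k) x * exp (- x\<^sup>2 / 2)) =
      (\<lambda>x :: real. (-1) ^ Suc k * poly (hermite_poly (Suc k)) x * exp (- x\<^sup>2 / 2))"
    by (intro ext DERIV_imp_deriv)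
  with Suc show ?case
    by simp
qed simp

lemma hermite_eq_poly: "hermite k x = poly (hermite_poly k) x"
proof -
  have "hermite k x = ((-1) ^ k * (-1) ^ k) * poly (hermite_poly k) x * (exp (x\<^sup>2 / 2) * exp (- x\<^sup>2 / 2))"
    unfolding hermite_def deriv_gauss_hermite_poly by (simp only: mult_ac)
  then show ?thesis
    by (simp flip: exp_add power_mult_distrib)
qed

lemma integrable_std_normal_power: "integrable std_normal_distribution (\<lambda>x. x ^ k)"
  using integrable_std_normal_moment[of k] by (simp add: integrable_density)

lemma integrable_std_normal_poly: "integrable std_normal_distribution (poly p)"
  unfolding poly_altdef
  by (intro Bochner_Integration.integrable_sum integrable_mult_right integrable_std_normal_power)

lemma poly_normal_L2: "poly p \<in> normal_L2"
proof -
  have "poly p \<in> borel_measurable borel"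
    by (intro borel_measurable_continuous_onI continuous_intros)
  moreover have "poly (p\<^sup>2) = (\<lambda>x. (poly p x)\<^sup>2)"
    by (simp add: fun_eq_iff poly_power)
  ultimately show ?thesis
    using integrable_std_normal_poly[of "p\<^sup>2"] by (simp add: normal_L2_def)
qed

lemma normalized_hermite_normal_L2: "normalized_hermite k \<in> normal_L2"
proof -
  have "normalized_hermite k = poly (smult (1 / sqrt (fact k)) (hermite_poly k))"
    by (simp add: fun_eq_iff normalized_hermite_def hermite_eq_poly)
  then show ?thesis
    by (simp only: poly_normal_L2)
qed

text \<open>The class of the normalized polynomial \<open>h\<^sub>k\<close> in \<open>\<bbbH>\<close>.\<close>

lift_definition hermite_basis :: "nat \<Rightarrow> hspace" is normalized_hermite
  by (simp add: normal_L2_rel_refl normalized_hermite_normal_L2)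

subsection \<open>Orthonormality\<close>

lemma hermite_poly_pderiv: "pderiv (hermite_poly (Suc k)) = smult (of_nat (Suc k)) (hermite_poly k)"
proof (induction k)
  case (Suc k)
  have "pderiv (hermite_poly (Suc (Suc k))) =
      hermite_poly (Suc k) + pCons 0 (pderiv (hermite_poly (Suc k))) - pderiv (pderiv (hermite_poly (Suc k)))"
    by (simp add: pderiv_diff pderiv_pCons)
  also have "\<dots> = hermite_poly (Suc k) + smult (of_nat (Suc k)) (pCons 0 (hermite_poly k) - pderiv (hermite_poly k))"
    unfolding Suc by (simp add: pderiv_smult smult_diff_right)
  also have "pCons 0 (hermite_poly k) - pderiv (hermite_poly k) = hermite_poly (Suc k)"
    by simp
  finally show ?case
    by (simp only: of_nat_Suc[of "Suc k"] smult_add_left smult_1_left)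
qed (simp add: pderiv_pCons)

lemma std_normal_poly_by_parts:
  "(\<integral>x. x * poly p x \<partial>std_normal_distribution) = (\<integral>x. poly (pderiv p) x \<partial>std_normal_distribution)"
proof -
  have mono: "(\<integral>x. x * x ^ n \<partial>std_normal_distribution) =
      real n * (\<integral>x. x ^ (n - 1) \<partial>std_normal_distribution)" for n
  proof (cases "even n")
    case True
    then obtain k where k: "n = 2 * k" by blast
    have odd: "(\<integral>x. x ^ (2 * j + 1) \<partial>std_normal_distribution) = 0" for j
      using integral_std_normal_moment_odd[of j] by (simp add: integral_density)
    show ?thesis
    proof (cases k)
      case 0
      then show ?thesis using odd[of 0] by (simp add: k)
    next
      case (Suc j)
      then show ?thesis using odd[of j] odd[of "Suc j"] by (simp add: k)
    qed
  next
    case False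
    then obtain k where k: "n = 2 * k + 1" by (blast elim: oddE)
    have even: "(\<integral>x. x ^ (2 * j) \<partial>std_normal_distribution) = fact (2 * j) / (2 ^ j * fact j)" for j
      using integral_std_normal_moment_even[of j] by (simp add: integral_density)
    have "(\<integral>x. x * x ^ n \<partial>std_normal_distribution) = (\<integral>x. x ^ (2 * Suc k) \<partial>std_normal_distribution)"
      by (simp add: k)
    also have "\<dots> = real n * (fact (2 * k) / (2 ^ k * fact k))"
      unfolding even by (simp add: k divide_simps del: of_nat_Suc) (simp add: algebra_simps)
    also have "\<dots> = real n * (\<integral>x. x ^ (n - 1) \<partial>std_normal_distribution)"
      unfolding even[symmetric] by (simp add: k)
    finally show ?thesis .
  qed
  have i: "integrable std_normal_distribution (\<lambda>x. x * poly p x)" for p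
  proof -
    have "poly (pCons 0 p) = (\<lambda>x. x * poly p x)"
      by (simp add: fun_eq_iff)
    then show ?thesis
      using integrable_std_normal_poly[of "pCons 0 p"] by simp
  qed
  have "(\<integral>x. x * poly (\<Sum>n\<in>S. Polynomial.monom (c n) n) x \<partial>std_normal_distribution) =
      (\<integral>x. poly (pderiv (\<Sum>n\<in>S. Polynomial.monom (c n) n)) x \<partial>std_normal_distribution)"
    if "finite S" for S c
    using that
  proof (induction S rule: finite_induct)
    case (insert n S)
    have "(\<integral>x. x * poly (Polynomial.monom (c n) n) x \<partial>std_normal_distribution) =
        (\<integral>x. c n * (x * x ^ n) \<partial>std_normal_distribution)"
      by (simp add: poly_monom mult.left_commute)
    also have "\<dots> = c n * (real n * (\<integral>x. x ^ (n - 1) \<partial>std_normal_distribution))"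
      by (simp only: integral_mult_right_zero mono)
    also have "\<dots> = (\<integral>x. poly (pderiv (Polynomial.monom (c n) n)) x \<partial>std_normal_distribution)"
      by (simp add: pderiv_monom poly_monom mult.commute mult.left_commute)
    finally show ?case
      using insert
      by (simp add: pderiv_add distrib_left i integrable_std_normal_poly del: poly_sum)
  qed simp
  from this[of "{..degree p}" "coeff p"] show ?thesis
    by (simp only: poly_as_sum_of_monoms finite_atMost)
qed

lemma std_normal_hermite_product:
  "(\<integral>x. poly (hermite_poly j) x * poly (hermite_poly k) x \<partial>std_normal_distribution) =
     (if j = k then fact k else 0)"
proof -
  interpret prob_space std_normal_distribution
    by (rule prob_space_std_normal_distribution)
  let ?E = "\<lambda>p. \<integral>x. poly p x \<partial>std_normal_distribution"
  have E_diff: "?E p - ?E q = ?E (p - q)" for p q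
  proof -
    have "poly (p - q) = (\<lambda>x. poly p x - poly q x)"
      by (simp add: fun_eq_iff)
    then show ?thesis by (simp add: integrable_std_normal_poly)
  qed
  have E_add: "?E p + ?E q = ?E (p + q)" for p q
  proof -
    have "poly (p + q) = (\<lambda>x. poly p x + poly q x)"
      by (simp add: fun_eq_iff)
    then show ?thesis by (simp add: integrable_std_normal_poly)
  qed
  have poly0: "poly 0 = (\<lambda>_. 0 :: real)"
    by (simp add: fun_eq_iff)
  have polysmult: "poly (smult c p) = (\<lambda>x. c * poly p x)" for c and p :: "real poly"
    by (simp add: fun_eq_iff)
  have poly_step: "hermite_poly (Suc j) * q = pCons 0 (hermite_poly j * q) - pderiv (hermite_poly j) * q" for j q
    by (simp add: algebra_simps)
  have step: "?E (hermite_poly (Suc j) * q) = ?E (hermite_poly j * pderiv q)" for j q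
  proof -
    have "?E (hermite_poly (Suc j) * q) =
        ?E (pCons 0 (hermite_poly j * q)) - ?E (pderiv (hermite_poly j) * q)"
      unfolding E_diff poly_step ..
    also have "?E (pCons 0 (hermite_poly j * q)) = ?E (pderiv (hermite_poly j * q))"
      using std_normal_poly_by_parts[of "hermite_poly j * q"] by simp
    also have "\<dots> = ?E (hermite_poly j * pderiv q) + ?E (pderiv (hermite_poly j) * q)"
      unfolding E_add by (simp only: pderiv_mult ac_simps)
    finally show ?thesis by simp
  qed
  have "?E (hermite_poly j * hermite_poly k) = (if j = k then fact k else 0)"
  proof (induction j arbitrary: k)
    case 0
    show ?case
    proof (cases k)
      case 0
      then show ?thesis using prob_space by simp
    next
      case (Suc l)
      have "?E (hermite_poly 0 * hermite_poly k) = ?E (hermite_poly (Suc l) * 1)"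
        by (simp only: Suc hermite_poly.simps(1) mult.commute)
      also have "\<dots> = 0"
        unfolding step by (simp add: poly0)
      finally show ?thesis by (simp add: Suc)
    qed
  next
    case (Suc j)
    show ?case
    proof (cases k)
      case 0
      then have "pderiv (hermite_poly k) = 0" by simp
      then show ?thesis unfolding step using 0 by (simp add: poly0)
    next
      case k: (Suc l)
      have "?E (hermite_poly (Suc j) * hermite_poly k) =
          ?E (smult (of_nat (Suc l)) (hermite_poly j * hermite_poly l))"
        unfolding step k hermite_poly_pderiv by (simp only: mult_smult_right)
      also have "\<dots> = of_nat (Suc l) * ?E (hermite_poly j * hermite_poly l)"
        by (simp only: polysmult integral_mult_right_zero)
      finally show ?thesis
        unfolding Suc by (simp add: k)
    qed
  qed
  then show ?thesis by simp
qed

lemma inner_hermite_basis: "hermite_basis j \<bullet> hermite_basis k = (if j = k then 1 else 0)"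
proof -
  have "hermite_basis j \<bullet> hermite_basis k =
      (\<integral>x. poly (hermite_poly j) x * poly (hermite_poly k) x / (sqrt (fact j) * sqrt (fact k))
         \<partial>std_normal_distribution)"
    by transfer (simp add: normalized_hermite_def hermite_eq_poly)
  also have "\<dots> = (if j = k then 1 else 0)"
    by (simp only: integral_divide_zero std_normal_hermite_product) simp
  finally show ?thesis .
qed

section \<open>The operators\<close>

text \<open>
  \<open>hermite_extend T\<close> is the linear extension of \<open>h\<^sub>k \<mapsto> T k\<close> along the Hermite expansion,
  \<open>h \<mapsto> \<Sum>k. \<langle>h, h\<^sub>k\<rangle> T k\<close>, as a series in \<open>\<bbbH>\<close>; its value is unspecified where the series
  diverges. The unbounded operators \<open>op_A\<close> and \<open>op_A_adj\<close> are thus meaningful only on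
  \<open>ladder_domain\<close>; see the summability lemmas below. In \<open>op_A\<close> the truncated \<open>k - 1\<close> at
  \<open>k = 0\<close> is harmless because the coefficient vanishes.
\<close>

definition hermite_extend :: "(nat \<Rightarrow> hspace) \<Rightarrow> hspace \<Rightarrow> hspace" where
  "hermite_extend T h = (\<Sum>k. (h \<bullet> hermite_basis k) *\<^sub>R T k)"

definition op_R :: "real \<Rightarrow> hspace \<Rightarrow> hspace" where
  "op_R \<rho> = hermite_extend (\<lambda>k. \<rho> ^ k *\<^sub>R hermite_basis k)"

definition op_A :: "hspace \<Rightarrow> hspace" where
  "op_A = hermite_extend (\<lambda>k. sqrt (real k) *\<^sub>R hermite_basis (k - 1))"

definition op_A_adj :: "hspace \<Rightarrow> hspace" where
  "op_A_adj = hermite_extend (\<lambda>k. sqrt (real (k + 1)) *\<^sub>R hermite_basis (k + 1))"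

definition ladder_domain :: "hspace set" where
  "ladder_domain = {h. summable (\<lambda>k. real k * (h \<bullet> hermite_basis k)\<^sup>2)}"

lemma hermite_extend_basis: "hermite_extend T (hermite_basis k) = T k"
proof -
  have "hermite_extend T (hermite_basis k) =
      (\<Sum>j\<in>{k}. (hermite_basis k \<bullet> hermite_basis j) *\<^sub>R T j)"
    unfolding hermite_extend_def
    by (rule suminf_finite) (auto simp: inner_hermite_basis)
  then show ?thesis
    by (simp add: inner_hermite_basis)
qed

lemma op_R_basis: "op_R \<rho> (hermite_basis k) = \<rho> ^ k *\<^sub>R hermite_basis k"
  by (simp add: op_R_def hermite_extend_basis)

lemma op_A_basis_0: "op_A (hermite_basis 0) = 0"
  by (simp add: op_A_def hermite_extend_basis)

lemma op_A_basis: "op_A (hermite_basis k) = sqrt (real k) *\<^sub>R hermite_basis (k - 1)"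
  by (simp add: op_A_def hermite_extend_basis)

lemma op_A_adj_basis:
  "op_A_adj (hermite_basis k) = sqrt (real (k + 1)) *\<^sub>R hermite_basis (k + 1)"
  by (simp add: op_A_adj_def hermite_extend_basis)

lemma bessel_hermite: "summable (\<lambda>k. (h \<bullet> hermite_basis k)\<^sup>2)"
proof (rule bounded_imp_summable)
  fix n
  let ?s = "\<Sum>k\<le>n. (h \<bullet> hermite_basis k) *\<^sub>R hermite_basis k"
  have a: "h \<bullet> ?s = (\<Sum>k\<le>n. (h \<bullet> hermite_basis k)\<^sup>2)"
    by (simp add: inner_sum_right power2_eq_square)
  have b: "?s \<bullet> ?s = (\<Sum>k\<le>n. (h \<bullet> hermite_basis k)\<^sup>2)"
    by (simp add: inner_sum_right inner_sum_left inner_hermite_basis if_distrib power2_eq_square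
        cong: if_cong)
  have "0 \<le> (h - ?s) \<bullet> (h - ?s)"
    by simp
  also have "\<dots> = h \<bullet> h - (\<Sum>k\<le>n. (h \<bullet> hermite_basis k)\<^sup>2)"
    using a b by (simp add: inner_diff_left inner_diff_right inner_commute[of ?s h])
  finally show "(\<Sum>k\<le>n. (h \<bullet> hermite_basis k)\<^sup>2) \<le> h \<bullet> h"
    by simp
qed simp

lemma summable_shifted_hermite:
  assumes s: "summable (\<lambda>k. (c k)\<^sup>2)" and e: "\<And>j k. j \<noteq> k \<Longrightarrow> e j \<bullet> e k = 0" "\<And>k. e k \<bullet> e k \<le> 1"
  shows "summable (\<lambda>k. c k *\<^sub>R (e k :: hspace))"
proof -
  have sq: "(norm (\<Sum>k=m..<n. c k *\<^sub>R e k))\<^sup>2 \<le> (\<Sum>k=m..<n. (c k)\<^sup>2)" for m n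
  proof -
    have "(norm (\<Sum>k=m..<n. c k *\<^sub>R e k))\<^sup>2 = (\<Sum>k=m..<n. \<Sum>j=m..<n. c k * c j * (e k \<bullet> e j))"
      by (simp add: power2_norm_eq_inner inner_sum_right inner_sum_left sum_distrib_left mult_ac)
        (subst sum.swap, simp add: inner_commute mult_ac)
    also have "\<dots> = (\<Sum>k=m..<n. (c k)\<^sup>2 * (e k \<bullet> e k))"
    proof (rule sum.cong[OF refl])
      fix k assume k: "k \<in> {m..<n}"
      have "(\<Sum>j=m..<n. c k * c j * (e k \<bullet> e j)) = (\<Sum>j=m..<n. if j = k then (c k)\<^sup>2 * (e k \<bullet> e k) else 0)"
        by (rule sum.cong) (auto simp: e(1) power2_eq_square)
      then show "(\<Sum>j=m..<n. c k * c j * (e k \<bullet> e j)) = (c k)\<^sup>2 * (e k \<bullet> e k)"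
        using k by simp
    qed
    also have "\<dots> \<le> (\<Sum>k=m..<n. (c k)\<^sup>2)"
      by (rule sum_mono) (simp add: e(2) mult_left_le)
    finally show ?thesis .
  qed
  show ?thesis
    unfolding summable_Cauchy
  proof (intro allI impI)
    fix r :: real assume r: "0 < r"
    then obtain N where N: "\<And>m n. m \<ge> N \<Longrightarrow> norm (\<Sum>k=m..<n. (c k)\<^sup>2) < r\<^sup>2"
      using s[unfolded summable_Cauchy] zero_less_power[OF r, of 2] by meson
    have "norm (\<Sum>k=m..<n. c k *\<^sub>R e k) < r" if "m \<ge> N" for m n
    proof (rule power2_less_imp_less)
      show "(norm (\<Sum>k=m..<n. c k *\<^sub>R e k))\<^sup>2 < r\<^sup>2"
        using sq[of m n] N[OF that, of n] by simp
    qed (use r in simp)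
    then show "\<exists>N. \<forall>m\<ge>N. \<forall>n. norm (\<Sum>k=m..<n. c k *\<^sub>R e k) < r"
      by blast
  qed
qed

lemma op_R_summable:
  assumes "\<bar>\<rho>\<bar> \<le> 1"
  shows "summable (\<lambda>k. (h \<bullet> hermite_basis k) *\<^sub>R \<rho> ^ k *\<^sub>R hermite_basis k)"
proof (rule summable_shifted_hermite[OF bessel_hermite])
  have "\<bar>\<rho> ^ k\<bar> \<le> 1" for k
    using assms by (simp add: power_abs power_le_one)
  then have "\<rho> ^ k * \<rho> ^ k \<le> 1" for k
    by (simp add: abs_square_le_1 flip: power2_eq_square)
  then show "(\<rho> ^ k *\<^sub>R hermite_basis k) \<bullet> (\<rho> ^ k *\<^sub>R hermite_basis k) \<le> 1" for k
    by (simp add: inner_hermite_basis)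
qed (simp add: inner_hermite_basis)

lemma op_A_summable:
  assumes "h \<in> ladder_domain"
  shows "summable (\<lambda>k. (h \<bullet> hermite_basis k) *\<^sub>R sqrt (real k) *\<^sub>R hermite_basis (k - 1))"
proof -
  have "summable (\<lambda>k. (sqrt (real k) * (h \<bullet> hermite_basis k))\<^sup>2)"
    using assms by (simp add: ladder_domain_def power_mult_distrib)
  then have "summable (\<lambda>k. (sqrt (real (Suc k)) * (h \<bullet> hermite_basis (Suc k)))\<^sup>2)"
    by (subst (asm) summable_Suc_iff[symmetric])
  then have "summable (\<lambda>k. (sqrt (real (Suc k)) * (h \<bullet> hermite_basis (Suc k))) *\<^sub>R hermite_basis k)"
    by (rule summable_shifted_hermite) (simp_all add: inner_hermite_basis)
  then have "summable (\<lambda>k. (h \<bullet> hermite_basis (Suc k)) *\<^sub>R sqrt (real (Suc k)) *\<^sub>R hermite_basis (Suc k - 1))"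
    by (simp add: mult.commute)
  then show ?thesis
    by (subst (asm) summable_Suc_iff)
qed

lemma op_A_adj_summable:
  assumes "h \<in> ladder_domain"
  shows "summable (\<lambda>k. (h \<bullet> hermite_basis k) *\<^sub>R sqrt (real (k + 1)) *\<^sub>R hermite_basis (k + 1))"
proof -
  have "summable (\<lambda>k. real k * (h \<bullet> hermite_basis k)\<^sup>2 + (h \<bullet> hermite_basis k)\<^sup>2)"
    using assms by (intro summable_add bessel_hermite) (simp add: ladder_domain_def)
  also have "(\<lambda>k. real k * (h \<bullet> hermite_basis k)\<^sup>2 + (h \<bullet> hermite_basis k)\<^sup>2) =
      (\<lambda>k. (sqrt (real (k + 1)) * (h \<bullet> hermite_basis k))\<^sup>2)"
    by (simp add: fun_eq_iff power_mult_distrib algebra_simps)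
  finally have "summable (\<lambda>k. (sqrt (real (k + 1)) * (h \<bullet> hermite_basis k)) *\<^sub>R hermite_basis (k + 1))"
    by (rule summable_shifted_hermite) (simp_all add: inner_hermite_basis)
  then show ?thesis
    by (simp add: mult.commute)
qed

section \<open>The transfer operator\<close>

definition transfer_fun :: "real \<Rightarrow> real \<Rightarrow> real \<Rightarrow> (real \<Rightarrow> real) \<Rightarrow> real \<Rightarrow> real" where
  "transfer_fun \<mu> \<rho> \<gamma> h x =
     (\<mu> + x) * (\<integral>y. h y * (exp (- (y - \<rho> * x)\<^sup>2 / (2 * \<gamma>\<^sup>2)) / (sqrt (2 * pi) * \<gamma>)) \<partial>lborel)"

context
  fixes \<rho> \<gamma> :: real
  assumes \<rho>: "0 < \<rho>" "\<rho> < 1" and \<gamma>: "\<gamma> = sqrt (1 - \<rho>\<^sup>2)"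
begin

lemma rho_sq_less_1: "\<rho>\<^sup>2 < 1"
  using \<rho> by (simp add: power_less_one_iff abs_square_less_1)

lemma gamma_sq: "\<gamma>\<^sup>2 = 1 - \<rho>\<^sup>2"
  using rho_sq_less_1 by (simp add: \<gamma>)

lemma gamma_pos: "0 < \<gamma>"
  using rho_sq_less_1 by (simp add: \<gamma>)

lemma transfer_kernel_eq:
  "exp (- (y - \<rho> * x)\<^sup>2 / (2 * \<gamma>\<^sup>2)) / (sqrt (2 * pi) * \<gamma>) = normal_density (\<rho> * x) \<gamma> y"
  using gamma_pos by (simp add: normal_density_def real_sqrt_mult)

lemma transfer_kernel_ratio:
  "(normal_density (\<rho> * x) \<gamma> y / std_normal_density y)\<^sup>2 * std_normal_density y =
     (sqrt ((1 - \<rho>\<^sup>2) / (1 + \<rho>\<^sup>2)) / (1 - \<rho>\<^sup>2)) * exp (\<rho>\<^sup>2 / (1 + \<rho>\<^sup>2) * x\<^sup>2) *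
     normal_density (2 * \<rho> * x / (1 + \<rho>\<^sup>2)) (sqrt ((1 - \<rho>\<^sup>2) / (1 + \<rho>\<^sup>2))) y"
proof -
  let ?c = "\<rho>\<^sup>2 / (1 + \<rho>\<^sup>2)" and ?m = "2 * \<rho> * x / (1 + \<rho>\<^sup>2)"
    and ?s = "sqrt ((1 - \<rho>\<^sup>2) / (1 + \<rho>\<^sup>2))"
  have p: "0 < 1 + \<rho>\<^sup>2"
    using zero_le_power2[of \<rho>] by linarith
  have d: "0 < 1 - \<rho>\<^sup>2"
    using rho_sq_less_1 by simp
  have s: "?s\<^sup>2 = (1 - \<rho>\<^sup>2) / (1 + \<rho>\<^sup>2)" "0 < ?s"
    using p d by simp_all
  have e: "- (y - \<rho> * x)\<^sup>2 / (1 - \<rho>\<^sup>2) + y\<^sup>2 / 2 = ?c * x\<^sup>2 + - (y - ?m)\<^sup>2 / (2 * ?s\<^sup>2)"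
  proof -
    define a b where "a = 1 + \<rho>\<^sup>2" and "b = 1 - \<rho>\<^sup>2"
    have [simp]: "a \<noteq> 0" "b \<noteq> 0"
      using d p by (simp_all add: a_def b_def)
    have k: "- (y - \<rho> * x)\<^sup>2 * (2 * a\<^sup>2) + y\<^sup>2 * (b * a\<^sup>2) =
        \<rho>\<^sup>2 * x\<^sup>2 * (2 * b * a) - (a * y - 2 * \<rho> * x)\<^sup>2 * a"
      unfolding a_def b_def by algebra
    have l: "y - 2 * \<rho> * x / a = (a * y - 2 * \<rho> * x) / a"
      by (simp add: field_simps)
    have gen: "(\<rho>\<^sup>2 * x\<^sup>2 * (2 * b * a) - z\<^sup>2 * a) / (2 * b * a\<^sup>2) =
        \<rho>\<^sup>2 / a * x\<^sup>2 + - (z / a)\<^sup>2 / (2 * (b / a))" for z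
      by (simp add: field_simps power2_eq_square)
    have "- (y - \<rho> * x)\<^sup>2 / b + y\<^sup>2 / 2 =
        (- (y - \<rho> * x)\<^sup>2 * (2 * a\<^sup>2) + y\<^sup>2 * (b * a\<^sup>2)) / (2 * b * a\<^sup>2)"
      by (simp add: add_divide_distrib diff_divide_distrib)
    then show ?thesis
      unfolding k gen unfolding l[symmetric] unfolding s a_def b_def .
  qed
  have "(normal_density (\<rho> * x) \<gamma> y / std_normal_density y)\<^sup>2 * std_normal_density y =
      (normal_density (\<rho> * x) \<gamma> y)\<^sup>2 / std_normal_density y"
    using normal_density_pos[of 1 0 y] by (simp add: power2_eq_square)
  also have "(normal_density (\<rho> * x) \<gamma> y)\<^sup>2 =
      1 / (2 * pi * (1 - \<rho>\<^sup>2)) * exp (- (y - \<rho> * x)\<^sup>2 / (1 - \<rho>\<^sup>2))"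
  proof -
    have "(exp (- (y - \<rho> * x)\<^sup>2 / (2 * (1 - \<rho>\<^sup>2))))\<^sup>2 = exp (- (y - \<rho> * x)\<^sup>2 / (1 - \<rho>\<^sup>2))"
    proof -
      have "(exp (z / (2 * b)))\<^sup>2 = exp (z / b)" for z b :: real
        by (simp flip: exp_double)
      then show ?thesis .
    qed
    moreover have "(1 / sqrt (2 * pi * (1 - \<rho>\<^sup>2)))\<^sup>2 = 1 / (2 * pi * (1 - \<rho>\<^sup>2))"
      using d by (simp add: power_divide)
    ultimately show ?thesis
      by (simp only: normal_density_def gamma_sq power_mult_distrib)
  qed
  also have "\<dots> / std_normal_density y =
      1 / (sqrt (2 * pi) * (1 - \<rho>\<^sup>2)) * exp (- (y - \<rho> * x)\<^sup>2 / (1 - \<rho>\<^sup>2) + y\<^sup>2 / 2)"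
  proof -
    have "2 * pi = sqrt (2 * pi) * sqrt (2 * pi)"
      by simp
    then have "1 / (2 * pi * (1 - \<rho>\<^sup>2)) * sqrt (2 * pi) =
        1 / ((sqrt (2 * pi) * sqrt (2 * pi)) * (1 - \<rho>\<^sup>2)) * sqrt (2 * pi)"
      by (simp only:)
    then have "1 / (2 * pi * (1 - \<rho>\<^sup>2)) * sqrt (2 * pi) = 1 / (sqrt (2 * pi) * (1 - \<rho>\<^sup>2))"
      using d by (simp only:) (simp add: divide_simps)
    moreover have "1 / std_normal_density y = sqrt (2 * pi) * exp (y\<^sup>2 / 2)"
      by (simp add: std_normal_density_def exp_minus field_simps)
    moreover have "A * E / N = A * sqrt (2 * pi) * (E * F)" if "1 / N = sqrt (2 * pi) * F" for A E N F
      using that by (simp add: divide_inverse mult_ac)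
    ultimately show ?thesis
      by (simp only: exp_add)
  qed
  also have "\<dots> = 1 / (sqrt (2 * pi) * (1 - \<rho>\<^sup>2)) *
      (exp (?c * x\<^sup>2) * exp (- (y - ?m)\<^sup>2 / (2 * ?s\<^sup>2)))"
    by (simp only: e exp_add)
  also have "\<dots> = ?s / (1 - \<rho>\<^sup>2) * exp (?c * x\<^sup>2) * normal_density ?m ?s y"
  proof -
    have "sqrt (2 * pi * ?s\<^sup>2) = sqrt (2 * pi) * ?s"
      using s(2) by (simp only: real_sqrt_mult real_sqrt_abs abs_of_pos)
    then show ?thesis
      unfolding normal_density_def using s(2) d p by simp
  qed
  finally show ?thesis .
qed

lemma transfer_ratio_normal_L2:
  "(\<lambda>y. normal_density (\<rho> * x) \<gamma> y / std_normal_density y) \<in> normal_L2" (is ?A)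
  and transfer_ratio_square_integral:
  "(\<integral>y. (normal_density (\<rho> * x) \<gamma> y / std_normal_density y)\<^sup>2 \<partial>std_normal_distribution) =
     (sqrt ((1 - \<rho>\<^sup>2) / (1 + \<rho>\<^sup>2)) / (1 - \<rho>\<^sup>2)) * exp (\<rho>\<^sup>2 / (1 + \<rho>\<^sup>2) * x\<^sup>2)" (is ?B)
proof -
  let ?s = "sqrt ((1 - \<rho>\<^sup>2) / (1 + \<rho>\<^sup>2))" and ?m = "2 * \<rho> * x / (1 + \<rho>\<^sup>2)"
  let ?g = "\<lambda>y. normal_density (\<rho> * x) \<gamma> y / std_normal_density y"
  let ?K = "?s / (1 - \<rho>\<^sup>2) * exp (\<rho>\<^sup>2 / (1 + \<rho>\<^sup>2) * x\<^sup>2)"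
  have s: "0 < ?s"
    using rho_sq_less_1 zero_le_power2[of \<rho>]
    by (intro real_sqrt_gt_zero divide_pos_pos) linarith+
  have eq: "(\<lambda>y. std_normal_density y *\<^sub>R (?g y)\<^sup>2) = (\<lambda>y. ?K * normal_density ?m ?s y)"
    using transfer_kernel_ratio[of x] by (simp only: real_scaleR_def mult.commute[of "std_normal_density _"])
  have "integrable std_normal_distribution (\<lambda>y. (?g y)\<^sup>2)"
    by (subst integrable_density)
      (simp_all only: eq integrable_mult_right integrable_normal_density[OF s], simp_all)
  then show ?A
    by (simp add: normal_L2_def)
  have "(\<integral>y. (?g y)\<^sup>2 \<partial>std_normal_distribution) = (\<integral>y. ?K * normal_density ?m ?s y \<partial>lborel)"
    by (subst integral_density) (simp_all only: eq, simp_all)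
  also have "\<dots> = ?K"
    by (simp only: integral_mult_right_zero integral_normal_density[OF s] mult_1_right)
  finally show ?B .
qed

lemma transfer_integrand_ratio:
  "h y * normal_density (\<rho> * x) \<gamma> y =
     std_normal_density y *\<^sub>R (h y * (normal_density (\<rho> * x) \<gamma> y / std_normal_density y))"
  using normal_density_pos[of 1 0 y] by simp

lemma transfer_integrable:
  assumes h: "h \<in> normal_L2"
  shows "integrable lborel (\<lambda>y. h y * (exp (- (y - \<rho> * x)\<^sup>2 / (2 * \<gamma>\<^sup>2)) / (sqrt (2 * pi) * \<gamma>)))"
proof -
  note [measurable] = normal_L2_measurable[OF h]
  show ?thesis
    using normal_L2_mult[OF h transfer_ratio_normal_L2[of x]]
    unfolding transfer_kernel_eq transfer_integrand_ratio
    by (subst (asm) integrable_density) simp_all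
qed

lemma transfer_integral_bound:
  assumes h: "h \<in> normal_L2"
  shows "(\<integral>y. h y * normal_density (\<rho> * x) \<gamma> y \<partial>lborel)\<^sup>2 \<le>
    (\<integral>y. (h y)\<^sup>2 \<partial>std_normal_distribution) *
    ((sqrt ((1 - \<rho>\<^sup>2) / (1 + \<rho>\<^sup>2)) / (1 - \<rho>\<^sup>2)) * exp (\<rho>\<^sup>2 / (1 + \<rho>\<^sup>2) * x\<^sup>2))"
proof -
  note [measurable] = normal_L2_measurable[OF h]
  let ?g = "\<lambda>y. normal_density (\<rho> * x) \<gamma> y / std_normal_density y"
  have "(\<integral>y. h y * ?g y \<partial>std_normal_distribution) =
      (\<integral>y. std_normal_density y *\<^sub>R (h y * ?g y) \<partial>lborel)"
    by (rule integral_density) simp_all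
  then have "(\<integral>y. h y * normal_density (\<rho> * x) \<gamma> y \<partial>lborel) = abs_hspace h \<bullet> abs_hspace ?g"
    by (simp only: transfer_integrand_ratio[of h] inner_abs_hspace h transfer_ratio_normal_L2)
  moreover have "(abs_hspace h \<bullet> abs_hspace ?g)\<^sup>2 \<le>
      (abs_hspace h \<bullet> abs_hspace h) * (abs_hspace ?g \<bullet> abs_hspace ?g)"
    by (rule Cauchy_Schwarz_ineq)
  moreover have "abs_hspace h \<bullet> abs_hspace h = (\<integral>y. (h y)\<^sup>2 \<partial>std_normal_distribution)"
    by (simp only: inner_abs_hspace h power2_eq_square)
  moreover have "abs_hspace ?g \<bullet> abs_hspace ?g = (\<integral>y. (?g y)\<^sup>2 \<partial>std_normal_distribution)"
    by (simp only: inner_abs_hspace transfer_ratio_normal_L2 power2_eq_square)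
  ultimately show ?thesis
    by (simp only: transfer_ratio_square_integral)
qed

lemma transfer_weight_integrable:
  "integrable std_normal_distribution (\<lambda>x. (\<mu> + x)\<^sup>2 * exp (\<rho>\<^sup>2 / (1 + \<rho>\<^sup>2) * x\<^sup>2))"
proof -
  let ?t = "sqrt ((1 + \<rho>\<^sup>2) / (1 - \<rho>\<^sup>2))"
  have p: "0 < 1 + \<rho>\<^sup>2"
    using zero_le_power2[of \<rho>] by linarith
  have d: "0 < 1 - \<rho>\<^sup>2"
    using rho_sq_less_1 by simp
  have t: "0 < ?t" "?t\<^sup>2 = (1 + \<rho>\<^sup>2) / (1 - \<rho>\<^sup>2)"
    using p d by simp_all
  have e: "- x\<^sup>2 / 2 + \<rho>\<^sup>2 / (1 + \<rho>\<^sup>2) * x\<^sup>2 = - x\<^sup>2 / (2 * ?t\<^sup>2)" for x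
    unfolding t using p d by (simp add: divide_simps) (simp add: algebra_simps)
  have sq: "sqrt (2 * pi * ?t\<^sup>2) = sqrt (2 * pi) * ?t"
    using t(1) by (simp only: real_sqrt_mult real_sqrt_abs abs_of_pos)
  have n: "std_normal_density x * exp (\<rho>\<^sup>2 / (1 + \<rho>\<^sup>2) * x\<^sup>2) = ?t * normal_density 0 ?t x" for x
  proof -
    have "std_normal_density x * exp (\<rho>\<^sup>2 / (1 + \<rho>\<^sup>2) * x\<^sup>2) =
        1 / sqrt (2 * pi) * exp (- x\<^sup>2 / 2 + \<rho>\<^sup>2 / (1 + \<rho>\<^sup>2) * x\<^sup>2)"
      by (simp only: std_normal_density_def exp_add mult.assoc)
    also have "\<dots> = ?t * normal_density 0 ?t x"
      unfolding e normal_density_def sq using t(1) d p by simp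
    finally show ?thesis .
  qed
  have eq: "(\<lambda>x. std_normal_density x *\<^sub>R ((\<mu> + x)\<^sup>2 * exp (\<rho>\<^sup>2 / (1 + \<rho>\<^sup>2) * x\<^sup>2))) =
      (\<lambda>x. ?t * (\<mu>\<^sup>2 * (normal_density 0 ?t x * (x - 0) ^ 0) +
        2 * \<mu> * (normal_density 0 ?t x * (x - 0) ^ 1) + normal_density 0 ?t x * (x - 0) ^ 2))"
  proof
    fix x
    have "std_normal_density x *\<^sub>R ((\<mu> + x)\<^sup>2 * exp (\<rho>\<^sup>2 / (1 + \<rho>\<^sup>2) * x\<^sup>2)) =
        (std_normal_density x * exp (\<rho>\<^sup>2 / (1 + \<rho>\<^sup>2) * x\<^sup>2)) * (\<mu> + x)\<^sup>2"
      by (simp only: real_scaleR_def mult_ac)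
    also have "\<dots> = ?t * normal_density 0 ?t x * (\<mu> + x)\<^sup>2"
      by (simp only: n)
    also have "\<dots> = ?t * (\<mu>\<^sup>2 * (normal_density 0 ?t x * (x - 0) ^ 0) +
        2 * \<mu> * (normal_density 0 ?t x * (x - 0) ^ 1) + normal_density 0 ?t x * (x - 0) ^ 2)"
      by (simp only: power2_sum power_0 power_one_right diff_0_right) algebra
    finally show "std_normal_density x *\<^sub>R ((\<mu> + x)\<^sup>2 * exp (\<rho>\<^sup>2 / (1 + \<rho>\<^sup>2) * x\<^sup>2)) = \<dots>" .
  qed
  have "integrable lborel (\<lambda>x. std_normal_density x *\<^sub>R ((\<mu> + x)\<^sup>2 * exp (\<rho>\<^sup>2 / (1 + \<rho>\<^sup>2) * x\<^sup>2)))"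
    unfolding eq
    by (intro integrable_mult_right Bochner_Integration.integrable_add integrable_normal_moment t(1))
  then show ?thesis
    by (subst integrable_density) simp_all
qed

lemma transfer_fun_normal_L2:
  assumes h: "h \<in> normal_L2"
  shows "transfer_fun \<mu> \<rho> \<gamma> h \<in> normal_L2"
proof -
  note [measurable] = normal_L2_measurable[OF h]
  let ?c = "\<rho>\<^sup>2 / (1 + \<rho>\<^sup>2)"
  define K where "K = (\<integral>y. (h y)\<^sup>2 \<partial>std_normal_distribution) *
    (sqrt ((1 - \<rho>\<^sup>2) / (1 + \<rho>\<^sup>2)) / (1 - \<rho>\<^sup>2))"
  have m: "transfer_fun \<mu> \<rho> \<gamma> h \<in> borel_measurable borel"
    unfolding transfer_fun_def by measurable
  have "integrable std_normal_distribution (\<lambda>x. (transfer_fun \<mu> \<rho> \<gamma> h x)\<^sup>2)"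
  proof (rule Bochner_Integration.integrable_bound)
    show "integrable std_normal_distribution (\<lambda>x. K * ((\<mu> + x)\<^sup>2 * exp (?c * x\<^sup>2)))"
      by (intro integrable_mult_right transfer_weight_integrable)
    show "(\<lambda>x. (transfer_fun \<mu> \<rho> \<gamma> h x)\<^sup>2) \<in> borel_measurable std_normal_distribution"
      using m by simp
    have "(transfer_fun \<mu> \<rho> \<gamma> h x)\<^sup>2 \<le> K * ((\<mu> + x)\<^sup>2 * exp (?c * x\<^sup>2))" for x
    proof -
      have "(transfer_fun \<mu> \<rho> \<gamma> h x)\<^sup>2 =
          (\<mu> + x)\<^sup>2 * (\<integral>y. h y * normal_density (\<rho> * x) \<gamma> y \<partial>lborel)\<^sup>2"
        by (simp only: transfer_fun_def transfer_kernel_eq power_mult_distrib)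
      also have "\<dots> \<le> (\<mu> + x)\<^sup>2 * (K * exp (?c * x\<^sup>2))"
        using transfer_integral_bound[OF h, of x]
        by (intro mult_left_mono) (simp_all only: K_def mult.assoc zero_le_power2)
      finally show ?thesis
        by (simp only: mult.left_commute)
    qed
    then show "AE x in std_normal_distribution.
        norm ((transfer_fun \<mu> \<rho> \<gamma> h x)\<^sup>2) \<le> norm (K * ((\<mu> + x)\<^sup>2 * exp (?c * x\<^sup>2)))"
      by (intro AE_I2) (smt (verit) real_norm_def zero_le_power2)
  qed
  with m show ?thesis
    by (simp add: normal_L2_def)
qed

end

lemma transfer_fun_cong:
  assumes "normal_L2_rel g h"
  shows "transfer_fun \<mu> \<rho> \<gamma> g x = transfer_fun \<mu> \<rho> \<gamma> h x"
proof -
  have [measurable]: "g \<in> borel_measurable borel" "h \<in> borel_measurable borel"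
    using assms by (auto simp: normal_L2_rel_def normal_L2_def)
  have "AE y in std_normal_distribution. g y = h y"
    using assms by (simp add: normal_L2_rel_def)
  then have ae: "AE y in lborel. g y = h y"
    by (subst (asm) AE_density) (auto simp: normal_density_pos)
  have "(\<integral>y. g y * (exp (- (y - \<rho> * x)\<^sup>2 / (2 * \<gamma>\<^sup>2)) / (sqrt (2 * pi) * \<gamma>)) \<partial>lborel) =
      (\<integral>y. h y * (exp (- (y - \<rho> * x)\<^sup>2 / (2 * \<gamma>\<^sup>2)) / (sqrt (2 * pi) * \<gamma>)) \<partial>lborel)"
    using ae by (intro integral_cong_AE) auto
  then show ?thesis
    by (simp only: transfer_fun_def)
qed

text \<open>
  The integral operator on classes. It acts on \<open>\<bbbH>\<close> only in the parameter range tested below, and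
  is set to \<open>0\<close> for all other parameters.
\<close>

lift_definition transfer_op :: "real \<Rightarrow> real \<Rightarrow> real \<Rightarrow> hspace \<Rightarrow> hspace" is
  "\<lambda>\<mu> \<rho> \<gamma> h. if 0 < \<rho> \<and> \<rho> < 1 \<and> \<gamma> = sqrt (1 - \<rho>\<^sup>2) then transfer_fun \<mu> \<rho> \<gamma> h else (\<lambda>_. 0)"
  using transfer_fun_cong transfer_fun_normal_L2
  by (auto simp: normal_L2_rel_def normal_L2_zero)

lemma transfer_op_abs_hspace:
  assumes "0 < \<rho>" "\<rho> < 1" "\<gamma> = sqrt (1 - \<rho>\<^sup>2)" "h \<in> normal_L2"
  shows "transfer_op \<mu> \<rho> \<gamma> (abs_hspace h) = abs_hspace (transfer_fun \<mu> \<rho> \<gamma> h)"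
  using assms by (simp add: transfer_op.abs_eq normal_L2_rel_refl)

end

theory Submission
  imports Defs
begin

text \<open>
  Up to the factor \<open>\<mu> + x\<close>, the operator \<open>G\<close> averages \<open>h\<close> over the normal law with mean \<open>\<rho> x\<close>
  and variance \<open>\<gamma>\<^sup>2 = 1 - \<rho>\<^sup>2\<close>. This averaging is the Ornstein-Uhlenbeck semigroup at time
  \<open>- ln \<rho>\<close>, whose eigenfunctions are the Hermite polynomials: \<open>H\<^sub>k\<close> is mapped to
  \<open>\<rho>\<^sup>k H\<^sub>k\<close> (\<open>normal_expectation_hermite\<close>), which is the operator \<open>R\<close>. The three term recurrence
  \<open>x h\<^sub>k = sqrt (k + 1) h\<^sub>k\<^sub>+\<^sub>1 + sqrt k h\<^sub>k\<^sub>-\<^sub>1\<close> says that multiplication by \<open>x\<close> is \<open>A + A\<^sup>\<dagger>\<close>.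
  Hence \<open>G\<close> and \<open>(\<mu> I + A + A\<^sup>\<dagger>) R\<close> agree on every basis vector
  (\<open>transfer_op_hermite_basis\<close>), and the matrix entries follow by orthonormality.

  To pass from basis vectors to an arbitrary \<open>h\<close>, write \<open>h = \<Sum>k. \<langle>h, h\<^sub>k\<rangle> h\<^sub>k + r\<close> with \<open>r\<close>
  orthogonal to all \<open>h\<^sub>k\<close>. Boundedness of \<open>G\<close> (\<open>bounded_linear_transfer_op\<close>) lets \<open>G\<close> act on the
  series term by term, and the geometric factors \<open>\<rho>\<^sup>k\<close> put \<open>R h\<close> into the domain of \<open>A\<close> and
  \<open>A\<^sup>\<dagger>\<close>, so that the three series on the other side converge as well. It remains to see that
  \<open>G r = 0\<close> (\<open>transfer_op_orthogonal_hermite\<close>), which is the completeness of the Hermite basis in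
  the form needed: \<open>r\<close> is orthogonal to all powers, hence by expanding the exponential to
  \<open>exp (z y)\<close> for all complex \<open>z\<close>, hence by mixing over a normal law in \<open>z\<close> to
  \<open>exp (s y - (\<tau> y)\<^sup>2 / 2)\<close>. For fixed \<open>x\<close>, the kernel of \<open>G\<close> relative to the standard normal
  density is a multiple of such a function.
\<close>

section \<open>Hermite polynomials under a Gaussian kernel\<close>

lemma normal_expectation_poly:
  assumes "0 < s"
  shows "integrable lborel (\<lambda>y. normal_density m s y * poly p y)" (is ?A)
    and "(\<integral>y. normal_density m s y * poly p y \<partial>lborel) =
      (\<integral>z. poly (p \<circ>\<^sub>p [:m, s:]) z \<partial>std_normal_distribution)" (is ?B)
proof -
  have dens: "s * normal_density m s (m + s * z) = std_normal_density z" for z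
  proof -
    have "normal_density m s (m + s * z) = std_normal_density z / s"
      using assms by (simp add: normal_density_def power_mult_distrib real_sqrt_mult)
    then show ?thesis using assms by simp
  qed
  have eq: "s *\<^sub>R (normal_density m s (m + s * z) * poly p (m + s * z)) =
      std_normal_density z *\<^sub>R poly (p \<circ>\<^sub>p [:m, s:]) z" for z
    by (simp add: poly_pcompose mult.commute[of z s] flip: dens)
  have m: "poly q \<in> borel_measurable borel" for q :: "real poly"
    by (rule normal_L2_measurable[OF poly_normal_L2])
  have [measurable]: "poly p \<in> borel_measurable borel" by (rule m)
  have "integrable lborel (\<lambda>z. std_normal_density z *\<^sub>R poly (p \<circ>\<^sub>p [:m, s:]) z)"
    using integrable_std_normal_poly[of "p \<circ>\<^sub>p [:m, s:]"]
    by (subst (asm) integrable_density) (use m in simp_all)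
  then have "integrable lborel (\<lambda>z. normal_density m s (m + s * z) * poly p (m + s * z))"
    unfolding eq[symmetric] using assms by simp
  then show ?A
    using assms by (subst (asm) lborel_integrable_real_affine_iff) simp_all
  have "(\<integral>y. normal_density m s y * poly p y \<partial>lborel) =
      (\<integral>z. s *\<^sub>R (normal_density m s (m + s * z) * poly p (m + s * z)) \<partial>lborel)"
    using assms by (subst lborel_integral_real_affine[of s _ m]) simp_all
  also have "\<dots> = (\<integral>z. poly (p \<circ>\<^sub>p [:m, s:]) z \<partial>std_normal_distribution)"
    unfolding eq by (subst integral_density) (use m in simp_all)
  finally show ?B .
qed

text \<open>
  Stein's identity for the normal law with mean \<open>m\<close> and variance \<open>s\<^sup>2\<close>; the substitution
  \<open>y = m + s z\<close> reduces it to the standard normal case.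
\<close>

lemma normal_poly_by_parts:
  assumes "0 < s"
  shows "(\<integral>y. normal_density m s y * (y * poly p y) \<partial>lborel) =
    m * (\<integral>y. normal_density m s y * poly p y \<partial>lborel) +
    s\<^sup>2 * (\<integral>y. normal_density m s y * poly (pderiv p) y \<partial>lborel)"
proof -
  let ?q = "p \<circ>\<^sub>p [:m, s:]"
  have i: "integrable std_normal_distribution (\<lambda>z. z * poly ?q z)"
  proof -
    have "poly (pCons 0 ?q) = (\<lambda>z. z * poly ?q z)"
      by (simp add: fun_eq_iff)
    then show ?thesis
      using integrable_std_normal_poly[of "pCons 0 ?q"] by simp
  qed
  have j: "integrable std_normal_distribution (poly ?q)"
    by (rule integrable_std_normal_poly)
  have "(\<integral>y. normal_density m s y * (y * poly p y) \<partial>lborel) =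
      (\<integral>y. normal_density m s y * poly (pCons 0 p) y \<partial>lborel)"
    by simp
  also have "\<dots> = (\<integral>z. m * poly ?q z + s * (z * poly ?q z) \<partial>std_normal_distribution)"
    unfolding normal_expectation_poly(2)[OF assms]
    by (rule Bochner_Integration.integral_cong) (simp_all add: poly_pcompose algebra_simps)
  also have "\<dots> = m * (\<integral>z. poly ?q z \<partial>std_normal_distribution) +
      s * (\<integral>z. poly (pderiv ?q) z \<partial>std_normal_distribution)"
    using i j by (simp add: std_normal_poly_by_parts)
  also have "pderiv ?q = smult s (pderiv p \<circ>\<^sub>p [:m, s:])"
    by (simp add: pderiv_pcompose pderiv_pCons)
  also have "(\<integral>z. poly (smult s (pderiv p \<circ>\<^sub>p [:m, s:])) z \<partial>std_normal_distribution) =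
      s * (\<integral>z. poly (pderiv p \<circ>\<^sub>p [:m, s:]) z \<partial>std_normal_distribution)"
    by simp
  finally show ?thesis
    by (simp add: normal_expectation_poly(2)[OF assms] power2_eq_square)
qed

lemma pderiv_hermite_poly: "pderiv (hermite_poly k) = smult (real k) (hermite_poly (k - 1))"
  by (cases k) (simp_all only: hermite_poly_pderiv diff_Suc_1, simp)

lemma hermite_poly_mult_x:
  "x * poly (hermite_poly k) x =
     poly (hermite_poly (Suc k)) x + real k * poly (hermite_poly (k - 1)) x"
  by (simp add: pderiv_hermite_poly)

text \<open>
  Write \<open>E\<close> for the expectation. Stein's identity applied to \<open>H\<^sub>j\<^sub>+\<^sub>1 = y H\<^sub>j - H\<^sub>j'\<close> gives
  \<open>E H\<^sub>j\<^sub>+\<^sub>1 = \<rho> x E H\<^sub>j + (s\<^sup>2 - 1) E H\<^sub>j'\<close>. Since \<open>s\<^sup>2 - 1 = - \<rho>\<^sup>2\<close> and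
  \<open>H\<^sub>j' = j H\<^sub>j\<^sub>-\<^sub>1\<close>, the induction hypotheses for \<open>j\<close> and \<open>j - 1\<close> turn the right-hand side into
  \<open>\<rho>\<^sup>j\<^sup>+\<^sup>1 (x H\<^sub>j - H\<^sub>j')\<close>.
\<close>

lemma normal_expectation_hermite:
  assumes "0 < s" "s\<^sup>2 = 1 - \<rho>\<^sup>2"
  shows "(\<integral>y. normal_density (\<rho> * x) s y * poly (hermite_poly k) y \<partial>lborel) =
    \<rho> ^ k * poly (hermite_poly k) x"
proof (induction k rule: less_induct)
  case (less k)
  let ?E = "\<lambda>p. \<integral>y. normal_density (\<rho> * x) s y * poly p y \<partial>lborel"
  show ?case
  proof (cases k)
    case 0
    then show ?thesis using integral_normal_density[OF assms(1)] by simp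
  next
    case (Suc j)
    have xi: "integrable lborel (\<lambda>y. normal_density (\<rho> * x) s y * (y * poly p y))" for p
      using normal_expectation_poly(1)[OF assms(1), of _ "pCons 0 p"] by simp
    have "?E (hermite_poly (Suc j)) =
        (\<integral>y. normal_density (\<rho> * x) s y * (y * poly (hermite_poly j) y) \<partial>lborel)
          - ?E (pderiv (hermite_poly j))"
      by (simp add: right_diff_distrib xi normal_expectation_poly(1)[OF assms(1)])
    also have "\<dots> = \<rho> * x * ?E (hermite_poly j) - \<rho>\<^sup>2 * ?E (pderiv (hermite_poly j))"
      unfolding normal_poly_by_parts[OF assms(1)] assms(2) by (simp add: algebra_simps)
    also have "?E (hermite_poly j) = \<rho> ^ j * poly (hermite_poly j) x"
      by (rule less) (simp add: Suc)
    also have "\<rho>\<^sup>2 * ?E (pderiv (hermite_poly j)) = \<rho> ^ Suc j * poly (pderiv (hermite_poly j)) x"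
    proof (cases j)
      case (Suc i)
      have "?E (hermite_poly i) = \<rho> ^ i * poly (hermite_poly i) x"
        by (rule less) (simp add: \<open>k = Suc j\<close> Suc)
      then show ?thesis
        by (simp add: Suc hermite_poly_pderiv mult.left_commute[of "normal_density _ _ _"]
            power2_eq_square mult_ac del: hermite_poly.simps)
    qed simp
    finally show ?thesis
      by (simp add: Suc algebra_simps)
  qed
qed

section \<open>The ladder relation and the action on the basis\<close>

lemma normalized_hermite_mult_x:
  "x * normalized_hermite k x = sqrt (real (k + 1)) * normalized_hermite (k + 1) x +
     sqrt (real k) * normalized_hermite (k - 1) x"
proof -
  have up: "hermite (k + 1) x / sqrt (fact k) = sqrt (real (k + 1)) * normalized_hermite (k + 1) x"
    by (simp add: normalized_hermite_def real_sqrt_mult del: of_nat_Suc)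
  have down: "real k * hermite (k - 1) x / sqrt (fact k) = sqrt (real k) * normalized_hermite (k - 1) x"
  proof (cases k)
    case (Suc j)
    have "real (Suc j) / sqrt (real (Suc j)) = sqrt (real (Suc j))"
      by (rule real_div_sqrt) simp
    then show ?thesis
      by (simp add: Suc normalized_hermite_def real_sqrt_mult del: of_nat_Suc)
        (metis divide_divide_eq_left times_divide_eq_left)
  qed simp
  have "x * normalized_hermite k x =
      hermite (k + 1) x / sqrt (fact k) + real k * hermite (k - 1) x / sqrt (fact k)"
    unfolding normalized_hermite_def times_divide_eq_right hermite_eq_poly hermite_poly_mult_x
    by (simp add: add_divide_distrib)
  then show ?thesis unfolding up down .
qed

context
  fixes \<rho> \<gamma> \<mu> :: real
  assumes par: "0 < \<rho>" "\<rho> < 1" "\<gamma> = sqrt (1 - \<rho>\<^sup>2)"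
begin

lemma transfer_fun_eq_normal_density:
  "transfer_fun \<mu> \<rho> \<gamma> h x = (\<mu> + x) * (\<integral>y. h y * normal_density (\<rho> * x) \<gamma> y \<partial>lborel)"
  by (simp only: transfer_fun_def transfer_kernel_eq[OF par])

lemma transfer_fun_hermite:
  "transfer_fun \<mu> \<rho> \<gamma> (normalized_hermite k) x = (\<mu> + x) * (\<rho> ^ k * normalized_hermite k x)"
proof -
  have "(\<integral>y. normalized_hermite k y * normal_density (\<rho> * x) \<gamma> y \<partial>lborel) =
      (\<integral>y. normal_density (\<rho> * x) \<gamma> y * poly (hermite_poly k) y / sqrt (fact k) \<partial>lborel)"
    by (simp add: normalized_hermite_def hermite_eq_poly mult.commute)
  also have "\<dots> = \<rho> ^ k * normalized_hermite k x"
    using normal_expectation_hermite[OF gamma_pos[OF par] gamma_sq[OF par]]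
    by (simp add: normalized_hermite_def hermite_eq_poly)
  finally show ?thesis
    by (simp only: transfer_fun_eq_normal_density)
qed

lemma transfer_op_hermite_basis:
  "transfer_op \<mu> \<rho> \<gamma> (hermite_basis k) = \<rho> ^ k *\<^sub>R (\<mu> *\<^sub>R hermite_basis k +
     sqrt (real k) *\<^sub>R hermite_basis (k - 1) + sqrt (real (k + 1)) *\<^sub>R hermite_basis (k + 1))"
proof -
  note L2 = normalized_hermite_normal_L2
  have fn: "transfer_fun \<mu> \<rho> \<gamma> (normalized_hermite k) = (\<lambda>x. \<rho> ^ k * (\<mu> * normalized_hermite k x +
      sqrt (real k) * normalized_hermite (k - 1) x + sqrt (real (k + 1)) * normalized_hermite (k + 1) x))"
    (is "_ = (\<lambda>x. ?c * ?g x)")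
  proof
    fix x
    have "(\<mu> + x) * (\<rho> ^ k * normalized_hermite k x) =
        \<rho> ^ k * (\<mu> * normalized_hermite k x + x * normalized_hermite k x)"
      by (simp add: algebra_simps)
    then show "transfer_fun \<mu> \<rho> \<gamma> (normalized_hermite k) x = ?c * ?g x"
      unfolding transfer_fun_hermite normalized_hermite_mult_x by (simp add: ac_simps)
  qed
  have "transfer_op \<mu> \<rho> \<gamma> (hermite_basis k) = abs_hspace (\<lambda>x. ?c * ?g x)"
    unfolding hermite_basis.abs_eq by (simp only: transfer_op_abs_hspace[OF par L2] fn)
  also have "\<dots> = \<rho> ^ k *\<^sub>R (\<mu> *\<^sub>R hermite_basis k +
     sqrt (real k) *\<^sub>R hermite_basis (k - 1) + sqrt (real (k + 1)) *\<^sub>R hermite_basis (k + 1))"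
    unfolding hermite_basis.abs_eq
    by (simp only: scaleR_hspace.abs_eq plus_hspace.abs_eq normal_L2_rel_refl normal_L2_scale
        normal_L2_add L2)
  finally show ?thesis .
qed

section \<open>Boundedness of the transfer operator\<close>

text \<open>
  The Cauchy-Schwarz inequality bounds the square of the integral at \<open>x\<close> by \<open>(norm h)\<^sup>2\<close> times a
  multiple of \<open>exp (c * x\<^sup>2)\<close> with \<open>c = \<rho>\<^sup>2 / (1 + \<rho>\<^sup>2) < 1/2\<close>. The product of this exponential
  with \<open>(\<mu> + x)\<^sup>2\<close> is integrable for the standard normal law.
\<close>

lemma transfer_op_norm_bound:
  "\<exists>K. \<forall>h. norm (transfer_op \<mu> \<rho> \<gamma> h) \<le> K * norm h"
proof -
  let ?w = "\<lambda>x. (\<mu> + x)\<^sup>2 * exp (\<rho>\<^sup>2 / (1 + \<rho>\<^sup>2) * x\<^sup>2)"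
  define B where "B = sqrt ((1 - \<rho>\<^sup>2) / (1 + \<rho>\<^sup>2)) / (1 - \<rho>\<^sup>2)"
  define J where "J = (\<integral>x. ?w x \<partial>std_normal_distribution)"
  have "0 < 1 - \<rho>\<^sup>2"
    using rho_sq_less_1[OF par] by simp
  then have B: "0 \<le> B"
    by (simp add: B_def)
  have J: "0 \<le> J"
    by (simp add: J_def)
  have "norm (transfer_op \<mu> \<rho> \<gamma> h) \<le> sqrt (B * J) * norm h" for h
  proof -
    obtain f where f: "f \<in> normal_L2" "h = abs_hspace f"
      by (rule hspace_cases)
    have Tf: "transfer_fun \<mu> \<rho> \<gamma> f \<in> normal_L2"
      by (rule transfer_fun_normal_L2[OF par f(1)])
    have pt: "(transfer_fun \<mu> \<rho> \<gamma> f x)\<^sup>2 \<le> ((norm h)\<^sup>2 * B) * ?w x" for x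
    proof -
      have "(\<integral>y. f y * normal_density (\<rho> * x) \<gamma> y \<partial>lborel)\<^sup>2 \<le>
          (norm h)\<^sup>2 * (B * exp (\<rho>\<^sup>2 / (1 + \<rho>\<^sup>2) * x\<^sup>2))"
        using transfer_integral_bound[OF par f(1), of x] by (simp only: f norm_abs_hspace B_def)
      then have "(\<mu> + x)\<^sup>2 * (\<integral>y. f y * normal_density (\<rho> * x) \<gamma> y \<partial>lborel)\<^sup>2 \<le>
          (\<mu> + x)\<^sup>2 * ((norm h)\<^sup>2 * (B * exp (\<rho>\<^sup>2 / (1 + \<rho>\<^sup>2) * x\<^sup>2)))"
        by (rule mult_left_mono) simp
      then show ?thesis
        by (simp only: transfer_fun_eq_normal_density power_mult_distrib mult_ac)
    qed
    have "(norm (transfer_op \<mu> \<rho> \<gamma> h))\<^sup>2 = (\<integral>x. (transfer_fun \<mu> \<rho> \<gamma> f x)\<^sup>2 \<partial>std_normal_distribution)"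
      by (simp only: f transfer_op_abs_hspace[OF par f(1)] norm_abs_hspace Tf)
    also have "\<dots> \<le> (\<integral>x. ((norm h)\<^sup>2 * B) * ?w x \<partial>std_normal_distribution)"
      by (intro integral_mono normal_L2_square Tf integrable_mult_right
          transfer_weight_integrable[OF par] pt)
    also have "\<dots> = (norm h)\<^sup>2 * B * J"
      by (simp only: integral_mult_right_zero J_def)
    also have "\<dots> = (sqrt (B * J) * norm h)\<^sup>2"
      using B J by (simp add: power_mult_distrib)
    finally show ?thesis
      by (rule power2_le_imp_le) (use B J in simp)
  qed
  then show ?thesis
    by blast
qed

lemma bounded_linear_transfer_op: "bounded_linear (transfer_op \<mu> \<rho> \<gamma>)"
proof -
  note i = transfer_integrable[OF par]
  have "transfer_op \<mu> \<rho> \<gamma> (g + h) = transfer_op \<mu> \<rho> \<gamma> g + transfer_op \<mu> \<rho> \<gamma> h" for g h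
  proof -
    obtain a b where a: "a \<in> normal_L2" "g = abs_hspace a" and b: "b \<in> normal_L2" "h = abs_hspace b"
      by (metis hspace_cases)
    have "transfer_fun \<mu> \<rho> \<gamma> (\<lambda>x. a x + b x) = (\<lambda>x. transfer_fun \<mu> \<rho> \<gamma> a x + transfer_fun \<mu> \<rho> \<gamma> b x)"
      by (rule ext) (simp only: transfer_fun_def distrib_right distrib_left
          Bochner_Integration.integral_add[OF i[OF a(1)] i[OF b(1)]])
    then show ?thesis
      by (simp only: a b plus_hspace.abs_eq normal_L2_rel_refl normal_L2_add
          transfer_op_abs_hspace[OF par] transfer_fun_normal_L2[OF par])
  qed
  moreover have "transfer_op \<mu> \<rho> \<gamma> (c *\<^sub>R h) = c *\<^sub>R transfer_op \<mu> \<rho> \<gamma> h" for c h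
  proof -
    obtain a where a: "a \<in> normal_L2" "h = abs_hspace a"
      by (rule hspace_cases)
    have "transfer_fun \<mu> \<rho> \<gamma> (\<lambda>x. c * a x) = (\<lambda>x. c * transfer_fun \<mu> \<rho> \<gamma> a x)"
      by (rule ext) (simp only: transfer_fun_def mult.assoc integral_mult_right_zero mult.left_commute[of _ c])
    then show ?thesis
      by (simp only: a scaleR_hspace.abs_eq normal_L2_rel_refl normal_L2_scale
          transfer_op_abs_hspace[OF par] transfer_fun_normal_L2[OF par])
  qed
  moreover obtain K where "\<And>h. norm (transfer_op \<mu> \<rho> \<gamma> h) \<le> K * norm h"
    using transfer_op_norm_bound by blast
  ultimately show ?thesis
    by (intro bounded_linear_intro[of _ K]) (auto simp: mult.commute)
qed

end

section \<open>Functions orthogonal to all Hermite polynomials\<close>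

lemma exp_abs_normal_L2: "(\<lambda>y. exp (a * \<bar>y\<bar>)) \<in> normal_L2"
proof -
  have i: "integrable std_normal_distribution (\<lambda>y. exp (b * y))" for b
  proof -
    have "std_normal_density y * exp (b * y) = exp (b\<^sup>2 / 2) * normal_density b 1 y" for y
      by (simp add: normal_density_def mult_exp_exp power2_eq_square field_simps)
    then have "integrable lborel (\<lambda>y. std_normal_density y *\<^sub>R exp (b * y))"
      by (simp add: integrable_normal_density)
    then show ?thesis
      by (subst integrable_density) simp_all
  qed
  have "integrable std_normal_distribution (\<lambda>y. (exp (a * \<bar>y\<bar>))\<^sup>2)"
  proof (rule Bochner_Integration.integrable_bound)
    have "(exp (a * \<bar>y\<bar>))\<^sup>2 \<le> exp (2 * a * y) + exp (- 2 * a * y)" for y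
      by (simp add: abs_if mult.assoc flip: exp_double)
    then show "AE y in std_normal_distribution.
        norm ((exp (a * \<bar>y\<bar>))\<^sup>2) \<le> norm (exp (2 * a * y) + exp (- 2 * a * y))"
      by (intro AE_I2) (smt (verit) real_norm_def zero_le_power2)
    show "integrable std_normal_distribution (\<lambda>y. exp (2 * a * y) + exp (- 2 * a * y))"
      by (intro Bochner_Integration.integrable_add i)
  qed simp
  then show ?thesis
    by (simp add: normal_L2_def)
qed

text \<open>
  The induction is on \<open>n\<close> for all products \<open>y\<^sup>n H\<^sub>k\<close> simultaneously: the recurrence for \<open>y H\<^sub>k\<close>
  trades one factor \<open>y\<close> for neighbouring indices, which avoids inverting the change of basis
  between powers and Hermite polynomials.
\<close>

lemma orthogonal_hermite_imp_orthogonal_power: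
  assumes f: "f \<in> normal_L2"
    and orth: "\<And>k. (\<integral>y. f y * poly (hermite_poly k) y \<partial>std_normal_distribution) = 0"
  shows "(\<integral>y. f y * y ^ n \<partial>std_normal_distribution) = 0"
proof -
  have i: "integrable std_normal_distribution (\<lambda>y. f y * (y ^ n * poly p y))" for n p
    using normal_L2_mult[OF f poly_normal_L2, of "Polynomial.monom 1 n * p"] by (simp add: poly_monom)
  have "(\<integral>y. f y * (y ^ n * poly (hermite_poly k) y) \<partial>std_normal_distribution) = 0" for k
  proof (induction n arbitrary: k)
    case (Suc n)
    have "f y * (y ^ Suc n * poly (hermite_poly k) y) =
        f y * (y ^ n * poly (hermite_poly (Suc k)) y) +
        real k * (f y * (y ^ n * poly (hermite_poly (k - 1)) y))" for y
      using arg_cong[OF hermite_poly_mult_x[of y k], of "\<lambda>t. f y * (y ^ n * t)"]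
      by (simp add: algebra_simps del: hermite_poly.simps)
    then show ?case
      by (simp add: i Suc del: hermite_poly.simps)
  qed (use orth in simp)
  from this[of 0] show ?thesis by simp
qed

text \<open>
  The partial sums of the exponential series integrate to \<open>0\<close>, and
  \<open>\<bar>f y\<bar> * exp (cmod z * \<bar>y\<bar>)\<close> dominates them.
\<close>

lemma orthogonal_power_imp_orthogonal_exp:
  assumes f: "f \<in> normal_L2"
    and orth: "\<And>n. (\<integral>y. f y * y ^ n \<partial>std_normal_distribution) = 0"
  shows "(\<integral>y. complex_of_real (f y) * exp (z * complex_of_real y) \<partial>std_normal_distribution) = 0"
proof -
  note [measurable] = normal_L2_measurable[OF f]
  let ?t = "\<lambda>n y. complex_of_real (f y) * ((z * complex_of_real y) ^ n /\<^sub>R fact n)"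
  let ?s = "\<lambda>i y. \<Sum>n<i. ?t n y"
  have i: "integrable std_normal_distribution (\<lambda>y. f y * y ^ n)" for n
    using normal_L2_mult[OF f poly_normal_L2, of "Polynomial.monom 1 n"] by (simp add: poly_monom)
  have t: "?t n = (\<lambda>y. (z ^ n /\<^sub>R fact n) * complex_of_real (f y * y ^ n))" for n
    by (simp add: fun_eq_iff power_mult_distrib scaleR_conv_of_real)
  have ti: "integrable std_normal_distribution (?t n)" for n
    unfolding t by (intro integrable_mult_right integrable_of_real i)
  have t0: "(\<integral>y. ?t n y \<partial>std_normal_distribution) = 0" for n
    unfolding t by (simp only: integral_mult_right_zero integral_complex_of_real orth) simp
  have s0: "(\<integral>y. ?s i y \<partial>std_normal_distribution) = 0" for i
    by (subst Bochner_Integration.integral_sum) (simp_all only: ti t0 sum.neutral_const)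
  have "(\<lambda>i. \<integral>y. ?s i y \<partial>std_normal_distribution) \<longlonglongrightarrow>
      (\<integral>y. complex_of_real (f y) * exp (z * complex_of_real y) \<partial>std_normal_distribution)"
  proof (rule integral_dominated_convergence)
    have "integrable std_normal_distribution (\<lambda>y. \<bar>f y * exp (cmod z * \<bar>y\<bar>)\<bar>)"
      by (intro integrable_abs normal_L2_mult f exp_abs_normal_L2)
    then show "integrable std_normal_distribution (\<lambda>y. \<bar>f y\<bar> * exp (cmod z * \<bar>y\<bar>))"
      by (simp add: abs_mult)
    show "AE y in std_normal_distribution.
        (\<lambda>i. ?s i y) \<longlonglongrightarrow> complex_of_real (f y) * exp (z * complex_of_real y)"
      unfolding sum_distrib_left[symmetric]
      using exp_converges[where 'a=complex] by (intro AE_I2 tendsto_intros) (simp add: sums_def)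
    show "AE y in std_normal_distribution. norm (?s i y) \<le> \<bar>f y\<bar> * exp (cmod z * \<bar>y\<bar>)" for i
    proof (rule AE_I2)
      fix y
      have "norm (\<Sum>n<i. (z * complex_of_real y) ^ n /\<^sub>R fact n) \<le>
          (\<Sum>n<i. (cmod z * \<bar>y\<bar>) ^ n /\<^sub>R fact n)"
        by (rule order_trans[OF norm_sum]) (simp add: norm_power norm_mult)
      also have "\<dots> \<le> exp (cmod z * \<bar>y\<bar>)"
        unfolding exp_def by (rule sum_le_suminf) (auto intro: summable_exp)
      finally show "norm (?s i y) \<le> \<bar>f y\<bar> * exp (cmod z * \<bar>y\<bar>)"
        unfolding sum_distrib_left[symmetric] norm_mult
        by (intro mult_mono) simp_all
    qed
  qed simp_all
  then show ?thesis
    unfolding s0 by (simp add: LIMSEQ_const_iff)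
qed

text \<open>
  The factor \<open>exp (- (\<tau> y)\<^sup>2 / 2)\<close> is the characteristic function of the standard normal law at
  \<open>\<tau> y\<close>. The function \<open>exp (s y - (\<tau> y)\<^sup>2 / 2)\<close> is therefore an average of the functions
  \<open>exp ((s + \<i> \<tau> t) y)\<close> over normally distributed \<open>t\<close>, and Fubini's theorem applies. Expanding the
  Gaussian factor in powers of \<open>y\<close> would not do: for large \<open>\<tau>\<close> its Taylor polynomials do not
  converge in mean square.
\<close>

lemma orthogonal_exp_imp_orthogonal_gauss:
  fixes s \<tau> :: real
  assumes f: "f \<in> normal_L2"
    and orth: "\<And>z. (\<integral>y. complex_of_real (f y) * exp (z * complex_of_real y) \<partial>std_normal_distribution) = 0"
  shows "(\<integral>y. f y * exp (s * y - (\<tau> * y)\<^sup>2 / 2) \<partial>std_normal_distribution) = 0"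
proof -
  note [measurable] = normal_L2_measurable[OF f]
  let ?N = std_normal_distribution
  interpret N: prob_space ?N
    by (rule prob_space_std_normal_distribution)
  interpret pair_sigma_finite ?N ?N
    by unfold_locales
  let ?F = "\<lambda>y t. complex_of_real (f y * exp (s * y)) * iexp (\<tau> * y * t)"
  have fe: "integrable ?N (\<lambda>y. \<bar>f y\<bar> * exp (s * y))"
  proof (rule Bochner_Integration.integrable_bound)
    show "integrable ?N (\<lambda>y. f y * exp (\<bar>s\<bar> * \<bar>y\<bar>))"
      by (intro normal_L2_mult f exp_abs_normal_L2)
    have "exp (s * y) \<le> exp (\<bar>s\<bar> * \<bar>y\<bar>)" for y
      using abs_ge_self[of "s * y"] by (simp add: abs_mult)
    then show "AE y in ?N. norm (\<bar>f y\<bar> * exp (s * y)) \<le> norm (f y * exp (\<bar>s\<bar> * \<bar>y\<bar>))"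
      by (intro AE_I2) (simp add: abs_mult mult_left_mono)
  qed simp
  have int: "integrable (?N \<Otimes>\<^sub>M ?N) (case_prod ?F)"
  proof (rule Fubini_integrable)
    show "integrable ?N (\<lambda>y. \<integral>t. norm (case_prod ?F (y, t)) \<partial>?N)"
      using fe N.prob_space by (simp add: norm_mult abs_mult)
    show "AE y in ?N. integrable ?N (\<lambda>t. case_prod ?F (y, t))"
    proof (rule AE_I2)
      fix y
      show "integrable ?N (\<lambda>t. case_prod ?F (y, t))"
        by (rule N.integrable_const_bound[where B = "norm (complex_of_real (f y * exp (s * y)))"])
          (simp_all add: norm_mult)
    qed
  qed measurable
  have inner: "(\<integral>t. ?F y t \<partial>?N) = complex_of_real (f y * exp (s * y - (\<tau> * y)\<^sup>2 / 2))" for y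
  proof -
    have "(\<integral>t. ?F y t \<partial>?N) = complex_of_real (f y * exp (s * y)) * char ?N (\<tau> * y)"
      by (simp add: char_def)
    also have "\<dots> = complex_of_real (f y * exp (s * y - (\<tau> * y)\<^sup>2 / 2))"
      by (simp only: char_std_normal_distribution mult.assoc mult_exp_exp flip: of_real_mult) simp
    finally show ?thesis .
  qed
  have outer: "(\<integral>y. ?F y t \<partial>?N) = 0" for t
  proof -
    have "?F y t = complex_of_real (f y) * exp ((complex_of_real s + \<i> * complex_of_real (\<tau> * t)) * complex_of_real y)" for y
      by (simp add: exp_of_real[symmetric] exp_add[symmetric] algebra_simps flip: exp_add)
    then show ?thesis
      by (simp only: orth)
  qed
  have "complex_of_real (\<integral>y. f y * exp (s * y - (\<tau> * y)\<^sup>2 / 2) \<partial>?N) = (\<integral>y. (\<integral>t. ?F y t \<partial>?N) \<partial>?N)"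
    by (simp only: inner integral_complex_of_real)
  also have "\<dots> = (\<integral>t. (\<integral>y. ?F y t \<partial>?N) \<partial>?N)"
    by (rule Fubini_integral[OF int, symmetric])
  also have "\<dots> = 0"
    by (simp only: outer) simp
  finally show ?thesis by simp
qed

lemma transfer_op_orthogonal_hermite:
  assumes par: "0 < \<rho>" "\<rho> < 1" "\<gamma> = sqrt (1 - \<rho>\<^sup>2)"
    and orth: "\<And>k. h \<bullet> hermite_basis k = 0"
  shows "transfer_op \<mu> \<rho> \<gamma> h = 0"
proof -
  obtain f where f: "f \<in> normal_L2" "h = abs_hspace f"
    by (rule hspace_cases)
  note [measurable] = normal_L2_measurable[OF f(1)]
  have "(\<integral>y. f y * poly (hermite_poly k) y \<partial>std_normal_distribution) = 0" for k
  proof -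
    have "h \<bullet> hermite_basis k = (\<integral>y. f y * poly (hermite_poly k) y / sqrt (fact k) \<partial>std_normal_distribution)"
      unfolding f(2) hermite_basis.abs_eq
      by (simp add: inner_abs_hspace f(1) normalized_hermite_normal_L2)
        (simp add: normalized_hermite_def hermite_eq_poly)
    then show ?thesis using orth[of k] by simp
  qed
  then have gauss: "(\<integral>y. f y * exp (s * y - (\<tau> * y)\<^sup>2 / 2) \<partial>std_normal_distribution) = 0" for s \<tau>
    by (intro orthogonal_exp_imp_orthogonal_gauss[OF f(1)] orthogonal_power_imp_orthogonal_exp[OF f(1)]
        orthogonal_hermite_imp_orthogonal_power[OF f(1)])
  have "transfer_fun \<mu> \<rho> \<gamma> f x = 0" for x
  proof -
    let ?s = "\<rho> * x / \<gamma>\<^sup>2" and ?\<tau> = "\<rho> / \<gamma>" and ?C = "exp (- (\<rho> * x)\<^sup>2 / (2 * \<gamma>\<^sup>2)) / \<gamma>"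
    have g: "0 < \<gamma>" "\<gamma>\<^sup>2 = 1 - \<rho>\<^sup>2"
      using gamma_pos[OF par] gamma_sq[OF par] .
    \<comment> \<open>Since \<open>1 / \<gamma>\<^sup>2 = 1 + (\<rho> / \<gamma>)\<^sup>2\<close>, splitting off the standard normal exponent leaves a
      negative quadratic term with coefficient \<open>?\<tau>\<^sup>2 / 2\<close>.\<close>
    have e: "- (y - \<rho> * x)\<^sup>2 / (2 * \<gamma>\<^sup>2) =
        - (\<rho> * x)\<^sup>2 / (2 * \<gamma>\<^sup>2) + (- y\<^sup>2 / 2 + (?s * y - (?\<tau> * y)\<^sup>2 / 2))" for y
    proof -
      have r: "\<rho>\<^sup>2 = 1 - \<gamma>\<^sup>2" using g(2) by simp
      have t: "(?\<tau> * y)\<^sup>2 = y\<^sup>2 / \<gamma>\<^sup>2 - y\<^sup>2"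
        using g(1) unfolding power_mult_distrib power_divide r by (simp add: field_simps)
      show ?thesis
        unfolding t using g(1) by (simp add: field_simps power2_eq_square)
    qed
    have k: "f y * normal_density (\<rho> * x) \<gamma> y =
        ?C * (std_normal_density y *\<^sub>R (f y * exp (?s * y - (?\<tau> * y)\<^sup>2 / 2)))" for y
    proof -
      have "normal_density (\<rho> * x) \<gamma> y = exp (- (y - \<rho> * x)\<^sup>2 / (2 * \<gamma>\<^sup>2)) / (sqrt (2 * pi) * \<gamma>)"
        by (simp only: transfer_kernel_eq[OF par])
      also have "\<dots> = ?C * (std_normal_density y * exp (?s * y - (?\<tau> * y)\<^sup>2 / 2))"
        unfolding e exp_add std_normal_density_def by (simp only: divide_inverse inverse_mult_distrib mult_ac mult_1_left)
      finally show ?thesis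
        by (simp only: real_scaleR_def mult_ac)
    qed
    have "(\<integral>y. f y * normal_density (\<rho> * x) \<gamma> y \<partial>lborel) =
        ?C * (\<integral>y. f y * exp (?s * y - (?\<tau> * y)\<^sup>2 / 2) \<partial>std_normal_distribution)"
      unfolding k integral_mult_right_zero by (subst integral_density) simp_all
    then show ?thesis
      by (simp only: transfer_fun_eq_normal_density[OF par] gauss mult_zero_right)
  qed
  then have "transfer_fun \<mu> \<rho> \<gamma> f = (\<lambda>_. 0)" by blast
  then show ?thesis
    by (simp only: f transfer_op_abs_hspace[OF par f(1)] zero_hspace.abs_eq)
qed

section \<open>The operator identity\<close>

lemma inner_op_R:
  assumes "\<bar>\<rho>\<bar> \<le> 1"
  shows "op_R \<rho> h \<bullet> hermite_basis k = \<rho> ^ k * (h \<bullet> hermite_basis k)"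
proof -
  have "op_R \<rho> h \<bullet> hermite_basis k =
      (\<Sum>j. ((h \<bullet> hermite_basis j) *\<^sub>R \<rho> ^ j *\<^sub>R hermite_basis j) \<bullet> hermite_basis k)"
    unfolding op_R_def hermite_extend_def
    by (rule bounded_linear.suminf[OF bounded_linear_inner_left op_R_summable[OF assms]])
  also have "\<dots> = (\<Sum>j\<in>{k}. ((h \<bullet> hermite_basis j) *\<^sub>R \<rho> ^ j *\<^sub>R hermite_basis j) \<bullet> hermite_basis k)"
    by (rule suminf_finite) (auto simp: inner_hermite_basis)
  finally show ?thesis
    by (simp add: inner_hermite_basis)
qed

text \<open>
  The coefficients of \<open>h\<close> are bounded by its norm, so the series defining the domain is dominated
  by the derivative of a geometric series with ratio \<open>\<rho>\<^sup>2\<close>.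
\<close>

lemma op_R_ladder_domain:
  assumes "\<bar>\<rho>\<bar> < 1"
  shows "op_R \<rho> h \<in> ladder_domain"
proof -
  have "\<bar>\<rho>\<^sup>2\<bar> < 1"
    using assms by (simp add: abs_square_less_1)
  then have "summable (\<lambda>k. real (Suc k) * (\<rho>\<^sup>2) ^ k)"
    using geometric_deriv_sums[of "\<rho>\<^sup>2"] by (auto simp: sums_iff)
  then have s: "summable (\<lambda>k. (norm h)\<^sup>2 * (real (Suc k) * (\<rho>\<^sup>2) ^ k))"
    by (rule summable_mult)
  have "summable (\<lambda>k. real k * (\<rho> ^ k * (h \<bullet> hermite_basis k))\<^sup>2)"
  proof (rule summable_comparison_test[OF _ s], intro exI allI impI)
    fix k
    have c: "(h \<bullet> hermite_basis k)\<^sup>2 \<le> (norm h)\<^sup>2"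
      using Cauchy_Schwarz_ineq[of h "hermite_basis k"]
      by (simp add: inner_hermite_basis power2_norm_eq_inner)
    have "real k * (\<rho> ^ k * (h \<bullet> hermite_basis k))\<^sup>2 =
        (h \<bullet> hermite_basis k)\<^sup>2 * (real k * (\<rho>\<^sup>2) ^ k)"
      by (simp add: power_mult_distrib power_mult[symmetric] mult.commute mult.left_commute)
    also have "\<dots> \<le> (norm h)\<^sup>2 * (real (Suc k) * (\<rho>\<^sup>2) ^ k)"
      by (intro mult_mono c mult_right_mono) simp_all
    finally show "norm (real k * (\<rho> ^ k * (h \<bullet> hermite_basis k))\<^sup>2) \<le>
        (norm h)\<^sup>2 * (real (Suc k) * (\<rho>\<^sup>2) ^ k)"
      by simp
  qed
  then show ?thesis
    using assms by (simp add: ladder_domain_def inner_op_R)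
qed

text \<open>
  The orthogonal projection of \<open>h\<close> onto the closed span of the basis is \<open>op_R 1 h\<close>; the operator
  annihilates the remainder and, being bounded, acts on the projection term by term.
\<close>

lemma transfer_op_hermite_expansion:
  assumes par: "0 < \<rho>" "\<rho> < 1" "\<gamma> = sqrt (1 - \<rho>\<^sup>2)"
  shows "(\<lambda>k. (h \<bullet> hermite_basis k) *\<^sub>R transfer_op \<mu> \<rho> \<gamma> (hermite_basis k)) sums transfer_op \<mu> \<rho> \<gamma> h"
proof -
  interpret T: bounded_linear "transfer_op \<mu> \<rho> \<gamma>"
    by (rule bounded_linear_transfer_op[OF par])
  let ?p = "op_R 1 h"
  have p: "(\<lambda>k. (h \<bullet> hermite_basis k) *\<^sub>R hermite_basis k) sums ?p"
    using op_R_summable[of 1 h] by (simp add: op_R_def hermite_extend_def summable_sums)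
  have "(h - ?p) \<bullet> hermite_basis k = 0" for k
    by (simp add: inner_diff_left inner_op_R)
  then have "transfer_op \<mu> \<rho> \<gamma> (h - ?p) = 0"
    by (rule transfer_op_orthogonal_hermite[OF par])
  then have "transfer_op \<mu> \<rho> \<gamma> h = transfer_op \<mu> \<rho> \<gamma> ?p"
    by (simp add: T.diff)
  with T.sums[OF p] show ?thesis
    by (simp add: T.scaleR)
qed

lemma transfer_op_eq_ladder:
  assumes par: "0 < \<rho>" "\<rho> < 1" "\<gamma> = sqrt (1 - \<rho>\<^sup>2)"
  shows "transfer_op \<mu> \<rho> \<gamma> h = \<mu> *\<^sub>R op_R \<rho> h + op_A (op_R \<rho> h) + op_A_adj (op_R \<rho> h)"
proof -
  have \<rho>: "\<bar>\<rho>\<bar> \<le> 1" "\<bar>\<rho>\<bar> < 1"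
    using par by simp_all
  note D = op_R_ladder_domain[OF \<rho>(2), of h]
  let ?e = hermite_basis
  let ?c = "\<lambda>k. \<rho> ^ k * (h \<bullet> ?e k)"
  have "(\<lambda>k. ?c k *\<^sub>R ?e k) sums op_R \<rho> h"
    using summable_sums[OF op_R_summable[OF \<rho>(1), of h]]
    by (simp add: op_R_def hermite_extend_def mult.commute)
  moreover have "(\<lambda>k. ?c k *\<^sub>R sqrt (real k) *\<^sub>R ?e (k - 1)) sums op_A (op_R \<rho> h)"
    using summable_sums[OF op_A_summable[OF D]]
    unfolding op_A_def hermite_extend_def inner_op_R[OF \<rho>(1)] .
  moreover have "(\<lambda>k. ?c k *\<^sub>R sqrt (real (k + 1)) *\<^sub>R ?e (k + 1)) sums op_A_adj (op_R \<rho> h)"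
    using summable_sums[OF op_A_adj_summable[OF D]]
    unfolding op_A_adj_def hermite_extend_def inner_op_R[OF \<rho>(1)] .
  ultimately have "(\<lambda>k. \<mu> *\<^sub>R (?c k *\<^sub>R ?e k) + ?c k *\<^sub>R sqrt (real k) *\<^sub>R ?e (k - 1) +
      ?c k *\<^sub>R sqrt (real (k + 1)) *\<^sub>R ?e (k + 1)) sums
      (\<mu> *\<^sub>R op_R \<rho> h + op_A (op_R \<rho> h) + op_A_adj (op_R \<rho> h))"
    by (intro sums_add sums_scaleR_right)
  also have "(\<lambda>k. \<mu> *\<^sub>R (?c k *\<^sub>R ?e k) + ?c k *\<^sub>R sqrt (real k) *\<^sub>R ?e (k - 1) +
      ?c k *\<^sub>R sqrt (real (k + 1)) *\<^sub>R ?e (k + 1)) =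
      (\<lambda>k. (h \<bullet> ?e k) *\<^sub>R transfer_op \<mu> \<rho> \<gamma> (?e k))"
    by (simp add: transfer_op_hermite_basis[OF par] scaleR_add_right mult_ac fun_eq_iff)
  finally show ?thesis
    using transfer_op_hermite_expansion[OF par] sums_unique2 by blast
qed

theorem theorem11p2:
  fixes \<alpha> \<beta> V \<mu> \<rho> \<gamma> :: real
  assumes "\<beta> > 0" and "\<alpha> > 0"
    and "\<mu> = exp (- \<beta> * V)"
    and "\<rho> = exp (- \<alpha> * \<beta>)"
    and "\<gamma> = sqrt (1 - \<rho>\<^sup>2)"
  shows "(\<forall>h. op_R \<rho> h \<in> ladder_domain)
    \<and> transfer_op \<mu> \<rho> \<gamma> = (\<lambda>h. \<mu> *\<^sub>R h + op_A h + op_A_adj h) \<circ> op_R \<rho>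
    \<and> (\<forall>k. hermite_basis k \<bullet> transfer_op \<mu> \<rho> \<gamma> (hermite_basis k) = \<mu> * \<rho> ^ k)
    \<and> (\<forall>k. hermite_basis (k + 1) \<bullet> transfer_op \<mu> \<rho> \<gamma> (hermite_basis k) =
           sqrt (real (k + 1)) * \<rho> ^ k)
    \<and> (\<forall>k. hermite_basis k \<bullet> transfer_op \<mu> \<rho> \<gamma> (hermite_basis (k + 1)) =
           sqrt (real (k + 1)) * \<rho> ^ (k + 1))
    \<and> (\<forall>j k. j \<noteq> k \<and> j \<noteq> k + 1 \<and> k \<noteq> j + 1 \<longrightarrow>
           hermite_basis j \<bullet> transfer_op \<mu> \<rho> \<gamma> (hermite_basis k) = 0)"
proof -
  have par: "0 < \<rho>" "\<rho> < 1" "\<gamma> = sqrt (1 - \<rho>\<^sup>2)"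
    using assms by simp_all
  have entry: "hermite_basis j \<bullet> transfer_op \<mu> \<rho> \<gamma> (hermite_basis k) =
      \<rho> ^ k * (\<mu> * (if j = k then 1 else 0) + sqrt (real k) * (if j = k - 1 then 1 else 0) +
        sqrt (real (k + 1)) * (if j = k + 1 then 1 else 0))" for j k
    by (simp only: transfer_op_hermite_basis[OF par] inner_scaleR_right inner_add_right inner_hermite_basis)
  have "\<bar>\<rho>\<bar> < 1"
    using par by simp
  then have "\<forall>h. op_R \<rho> h \<in> ladder_domain"
    by (blast intro: op_R_ladder_domain)
  moreover have "transfer_op \<mu> \<rho> \<gamma> = (\<lambda>h. \<mu> *\<^sub>R h + op_A h + op_A_adj h) \<circ> op_R \<rho>"
    by (simp add: fun_eq_iff transfer_op_eq_ladder[OF par])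
  moreover have "hermite_basis k \<bullet> transfer_op \<mu> \<rho> \<gamma> (hermite_basis k) = \<mu> * \<rho> ^ k" for k
    by (cases k) (simp_all add: entry)
  moreover have "hermite_basis (k + 1) \<bullet> transfer_op \<mu> \<rho> \<gamma> (hermite_basis k) =
      sqrt (real (k + 1)) * \<rho> ^ k" for k
    by (simp add: entry)
  moreover have "hermite_basis k \<bullet> transfer_op \<mu> \<rho> \<gamma> (hermite_basis (k + 1)) =
      sqrt (real (k + 1)) * \<rho> ^ (k + 1)" for k
    by (simp add: entry)
  moreover have "hermite_basis j \<bullet> transfer_op \<mu> \<rho> \<gamma> (hermite_basis k) = 0"
    if "j \<noteq> k \<and> j \<noteq> k + 1 \<and> k \<noteq> j + 1" for j k
    using that by (cases k) (simp_all add: entry)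
  ultimately show ?thesis
    by blast
qed

end
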